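(* For $\epsilon>0$ set $d=\epsilon^{-1/4}$. Then for all sufficiently small $\epsilon$ the following holds. Let $\mathcal{A}$ be a TDS learning algorithm for general halfspaces over $\mathbb{R}^d$ w.r.t. $\mathcal{N}_d$ with accuracy parameter $\epsilon$ and success probability at least $0.95$. Suppose $\mathcal{A}$ obtains at most $d^{\frac{\log 1/\epsilon}{\log\log 1/\epsilon}}$ samples from the training distribution and accesses the test distribution via $2^{d^{o(1)}}$ SQ queries of tolerance $\phi>0$ (the queries may depend on the training samples). Then $\phi\le d^{-\Omega(\frac{\log 1/\epsilon}{\log\log 1/\epsilon})}$.
   Context: $\mathcal{N}_d$ is the standard Gaussian on $\mathbb{R}^d$. A general halfspace is $\mathbf{x}\mapsto\mathrm{sign}(\mathbf{v}\cdot\mathbf{x}+\tau)$. Statistical query (SQ) access with tolerance $\phi$ to a distribution $\mathcal{D}$: the algorithm submits (adaptive) queries $q:\mathbb{R}^d\to[-1,1]$ and receives a value $v$ with $|v-\mathbb{E}_{\mathbf{x}\sim\mathcal{D}}[q(\mathbf{x})]|\le\phi$. A TDS learning algorithm for a class $\mathcal{C}$ with accuracy $\epsilon$ and success probability $1-\delta$: given labeled training examples $(\mathbf{x},c^*(\mathbf{x}))$ with $\mathbf{x}\sim\mathcal{N}_d$ i.i.d. and $c^*\in\mathcal{C}$, and access to an arbitrary test distribution $\mathcal{D}'$ (here via SQ queries), it rejects or accepts and outputs $h:\mathbb{R}^d\to\{\pm1\}$, such that (soundness) with probability $\ge1-\delta$, if it accepts then $\Pr_{\mathbf{x}\sim\mathcal{D}'}[c^*(\mathbf{x})\ne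 h(\mathbf{x})]\le\epsilon$, and (completeness) if $\mathcal{D}'=\mathcal{N}_d$ it accepts with probability $\ge 1-\delta$. *)

theory Defs
  imports "HOL-Probability.Probability"
begin

text \<open>
  The dimension \<open>d\<close> depends on the accuracy parameter, so it cannot be a type. Points of
  \<open>\<real>\<^sup>d\<close> are the elements of \<open>{..<d} \<rightarrow>\<^sub>E UNIV\<close>, i.e. of the space of the product measure below.
\<close>

definition gaussian :: "nat \<Rightarrow> (nat \<Rightarrow> real) measure" where
  "gaussian d = (\<Pi>\<^sub>M i\<in>{..<d}. density lborel (\<lambda>t. ennreal (std_normal_density t)))"

text \<open>Labels are \<open>\<plusminus>1\<close>, so unlike \<^const>\<open>sgn\<close> this sign function never vanishes.\<close>

definition pm_sign :: "real \<Rightarrow> real" where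
  "pm_sign t = (if t \<ge> 0 then 1 else -1)"

text \<open>
  The normal vector is required to be nonzero on the coordinates below \<open>d\<close>, so the constant
  functions are not in the class (this only enlarges the set of learners for the class).
\<close>

definition general_halfspaces :: "nat \<Rightarrow> ((nat \<Rightarrow> real) \<Rightarrow> real) set" where
  "general_halfspaces d =
     {\<lambda>x. pm_sign ((\<Sum>i<d. v i * x i) + \<tau>) | v \<tau>. \<exists>i<d. v i \<noteq> 0}"

definition sq_query :: "'a measure \<Rightarrow> ('a \<Rightarrow> real) \<Rightarrow> bool" where
  "sq_query M q \<longleftrightarrow> q \<in> borel_measurable M \<and> (\<forall>x\<in>space M. q x \<in> {-1..1})"

text \<open>An SQ oracle with tolerance \<open>\<phi>\<close> for \<open>D\<close> may answer each query by any value within \<open>\<phi>\<close> of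
  the expectation.\<close>

definition sq_oracle :: "'a measure \<Rightarrow> real \<Rightarrow> (('a \<Rightarrow> real) \<Rightarrow> real) \<Rightarrow> bool" where
  "sq_oracle D \<phi> orc \<longleftrightarrow> (\<forall>q. sq_query D q \<longrightarrow> \<bar>orc q - (\<integral>x. q x \<partial>D)\<bar> \<le> \<phi>)"

text \<open>
  The interaction with the test distribution, once the training sample and the internal
  randomness are fixed: a decision tree which either stops, rejecting or accepting with a
  hypothesis, or asks a query and continues depending on the answer.
\<close>

datatype 'a protocol =
    Reject
  | Accept "'a \<Rightarrow> real"
  | Query "'a \<Rightarrow> real" "real \<Rightarrow> 'a protocol"

primrec run :: "(('a \<Rightarrow> real) \<Rightarrow> real) \<Rightarrow> 'a protocol \<Rightarrow> ('a \<Rightarrow> real) option" where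
  "run orc Reject = None"
| "run orc (Accept h) = Some h"
| "run orc (Query q k) = run orc (k (orc q))"

primrec well_formed :: "'a measure \<Rightarrow> 'a protocol \<Rightarrow> bool" where
  "well_formed M Reject = True"
| "well_formed M (Accept h) = (h \<in> borel_measurable M \<and> (\<forall>x\<in>space M. h x \<in> {-1, 1}))"
| "well_formed M (Query q k) = (sq_query M q \<and> (\<forall>v. well_formed M (k v)))"

primrec at_most_queries :: "'a protocol \<Rightarrow> nat \<Rightarrow> bool" where
  "at_most_queries Reject n = True"
| "at_most_queries (Accept h) n = True"
| "at_most_queries (Query q k) n = (n > 0 \<and> (\<forall>v. at_most_queries (k v) (n - 1)))"

text \<open>
  A (randomized) algorithm maps its random seed and the labeled training sample to a protocol.
  The training sample is a list so that nothing about the target is visible except its values at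
  the sample points.
\<close>

type_synonym 'a tds_algorithm = "real \<Rightarrow> ('a \<times> real) list \<Rightarrow> 'a protocol"

definition labeled_sample :: "('a \<Rightarrow> real) \<Rightarrow> nat \<Rightarrow> (nat \<Rightarrow> 'a) \<Rightarrow> ('a \<times> real) list" where
  "labeled_sample c m x = map (\<lambda>i. (x i, c (x i))) [0..<m]"

text \<open>
  The oracle is an arbitrary function, so the set of outcomes on which the algorithm succeeds need
  not be measurable; it is required to contain an event of probability at least \<open>p\<close>.
\<close>

definition with_prob_at_least :: "'b measure \<Rightarrow> real \<Rightarrow> ('b \<Rightarrow> bool) \<Rightarrow> bool" where
  "with_prob_at_least M p P \<longleftrightarrow> (\<exists>E\<in>sets M. measure M E \<ge> p \<and> (\<forall>\<omega>\<in>E. P \<omega>))"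

text \<open>
  TDS learner for the class \<open>\<C>\<close> with respect to the distribution \<open>M\<close>, with accuracy \<open>\<epsilon>\<close> and
  success probability \<open>1 - \<delta>\<close>, using \<open>m\<close> training examples and SQ access with tolerance \<open>\<phi>\<close> to the
  test distribution \<open>D'\<close>. The random seed is drawn from \<open>R\<close>, independently of the sample.
\<close>

definition tds_sq_learner ::
  "('a \<Rightarrow> real) set \<Rightarrow> 'a measure \<Rightarrow> real \<Rightarrow> real \<Rightarrow> nat \<Rightarrow> real \<Rightarrow> real measure \<Rightarrow>
   'a tds_algorithm \<Rightarrow> bool" where
  "tds_sq_learner \<C> M \<epsilon> \<delta> m \<phi> R A \<longleftrightarrow>
     prob_space R \<and>
     (\<forall>r S. well_formed M (A r S)) \<and>
     (\<forall>c\<in>\<C>. \<forall>D' orc. prob_space D' \<longrightarrow> sets D' = sets M \<longrightarrow> sq_oracle D' \<phi> orc \<longrightarrow>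
        with_prob_at_least (R \<Otimes>\<^sub>M (\<Pi>\<^sub>M i\<in>{..<m}. M)) (1 - \<delta>)
          (\<lambda>(r, x). \<forall>h. run orc (A r (labeled_sample c m x)) = Some h \<longrightarrow>
             measure D' {z \<in> space D'. c z \<noteq> h z} \<le> \<epsilon>) \<and>
        (D' = M \<longrightarrow>
           with_prob_at_least (R \<Otimes>\<^sub>M (\<Pi>\<^sub>M i\<in>{..<m}. M)) (1 - \<delta>)
             (\<lambda>(r, x). run orc (A r (labeled_sample c m x)) \<noteq> None)))"

end

theory Submission
  imports Defs "HOL-Real_Asymp.Real_Asymp"
begin

text \<open>
  Write \<open>L = ln (1/\<epsilon>)\<close>. For a sign vector \<open>s\<close> and \<open>u = s / sqrt d\<close>, let \<open>D\<^sub>u\<close> have density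
  \<open>1 + \<Sum>\<^sub>a c\<^sub>a exp (a (u \<bullet> x) - a\<^sup>2/2)\<close> with respect to the Gaussian: weight \<open>\<beta> = 9 \<epsilon>\<close> at
  \<open>a = \<plusminus>\<tau>\<close> with \<open>\<tau> = L/4\<close>, compensated at \<open>n \<approx> L / (8 ln L)\<close> nodes in \<open>[0,1]\<close> by Lagrange weights
  that cancel the moments \<open>\<Sum>\<^sub>a c\<^sub>a a\<^sup>j\<close> for \<open>j < n\<close>. By the Gaussian moment generating function,
  the correlation of two such densities is \<open>\<Sum>\<^sub>a \<Sum>\<^sub>b c\<^sub>a c\<^sub>b exp (a b (u \<bullet> w))\<close>, which is
  \<open>d\<close> to the power \<open>-\<Omega>(n)\<close> when \<open>u\<close> and \<open>w\<close> are nearly orthogonal. As nearly all pairs of sign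
  vectors are, any fixed query distinguishes \<open>D\<^sub>u\<close> from the Gaussian only for a tiny fraction of
  the directions \<open>u\<close>.

  The halfspaces \<open>u \<bullet> x \<ge> \<tau> - 4\<close> and \<open>u \<bullet> x \<ge> \<tau> + 4\<close> have such small Gaussian measure that all
  training labels are \<open>-1\<close> for both, while \<open>D\<^sub>u\<close> gives their difference mass above \<open>2 \<epsilon>\<close>. If no
  query detects \<open>D\<^sub>u\<close>, the learner accepts by completeness, and its single hypothesis would have
  to be \<open>\<epsilon>\<close>-close under \<open>D\<^sub>u\<close> to both.
\<close>

subsection \<open>Learners that see the same transcript for many test distributions\<close>

text \<open>Only the branch followed under \<open>orc\<close> is collected. \<open>Query\<close>
  continues with a subtree for every real answer, whereas a single run visits finitely many
  queries.\<close>

primrec asked :: "(('a \<Rightarrow> real) \<Rightarrow> real) \<Rightarrow> 'a protocol \<Rightarrow> ('a \<Rightarrow> real) set" where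
  "asked orc Reject = {}"
| "asked orc (Accept h) = {}"
| "asked orc (Query q k) = insert q (asked orc (k (orc q)))"

text \<open>By induction, each next subtree is determined by an answer on which both oracles agree.
  This lets the oracle of a planted distribution pass for that of the Gaussian.\<close>

lemma run_cong_asked:
  "(\<And>q. q \<in> asked orc p \<Longrightarrow> orc' q = orc q) \<Longrightarrow> run orc' p = run orc p"
  by (induction p) auto

lemma card_asked:
  "at_most_queries p n \<Longrightarrow> finite (asked orc p) \<and> card (asked orc p) \<le> n"
proof (induction p arbitrary: n)
  case (Query q k)
  then have n: "n > 0" and 1: "finite (asked orc (k (orc q)))"
    "card (asked orc (k (orc q))) \<le> n - 1"
    by auto
  from 1 n show ?case
    using card_insert_le_m1[of n "asked orc (k (orc q))" q] by auto
qed auto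

lemma sq_query_asked:
  "well_formed M p \<Longrightarrow> q \<in> asked orc p \<Longrightarrow> sq_query M q"
  by (induction p) auto

lemma run_measurable:
  "well_formed M p \<Longrightarrow> run orc p = Some h \<Longrightarrow> h \<in> borel_measurable M"
  by (induction p) auto

text \<open>Each sample point has law \<open>M\<close> even with the seed adjoined, so a union bound
  over the \<open>m\<close> points applies. It is used with \<open>T\<close> the set where one of
  two targets is not \<open>-1\<close>.\<close>

lemma prob_some_component_le:
  fixes m :: nat
  assumes M: "prob_space M" and R: "prob_space R" and T: "T \<in> sets M"
  defines "\<Omega> \<equiv> R \<Otimes>\<^sub>M (\<Pi>\<^sub>M i\<in>{..<m}. M)"
  shows "{\<omega>\<in>space \<Omega>. \<exists>i<m. snd \<omega> i \<in> T} \<in> sets \<Omega>"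
    and "measure \<Omega> {\<omega>\<in>space \<Omega>. \<exists>i<m. snd \<omega> i \<in> T} \<le> real m * measure M T"
proof -
  interpret M: prob_space M by fact
  interpret R: prob_space R by fact
  let ?P = "\<Pi>\<^sub>M i\<in>{..<m}. M"
  interpret PP: product_prob_space "\<lambda>_. M" "{..<m}" by unfold_locales
  interpret P: prob_space ?P by (rule PP.prob_space_axioms)
  interpret RP: pair_prob_space R ?P by unfold_locales
  interpret \<Omega>: prob_space \<Omega> unfolding \<Omega>_def by unfold_locales
  have comp[measurable]: "(\<lambda>\<omega>. snd \<omega> i) \<in> measurable \<Omega> M" if "i < m" for i
    unfolding \<Omega>_def using that
    by (intro measurable_compose[OF measurable_snd measurable_component_singleton]) auto
  have "distr \<Omega> M (\<lambda>\<omega>. snd \<omega> i) = M" if i: "i < m" for i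
  proof -
    have "distr \<Omega> M (\<lambda>\<omega>. snd \<omega> i) = distr (distr \<Omega> ?P snd) M (\<lambda>x. x i)"
      using i by (subst distr_distr) (auto simp: \<Omega>_def comp_def)
    also have "distr \<Omega> ?P snd = ?P"
    proof (rule measure_eqI)
      fix X assume "X \<in> sets (distr \<Omega> ?P snd)"
      then have X: "X \<in> sets ?P" by simp
      have "emeasure (distr \<Omega> ?P snd) X = emeasure \<Omega> (snd -` X \<inter> space \<Omega>)"
        using X by (simp add: emeasure_distr \<Omega>_def)
      also have "snd -` X \<inter> space \<Omega> = space R \<times> X"
        using sets.sets_into_space[OF X] by (auto simp: \<Omega>_def space_pair_measure)
      also have "emeasure \<Omega> (space R \<times> X) = emeasure ?P X"
        unfolding \<Omega>_def using X by (simp add: sigma_finite_measure.emeasure_pair_measure_Times[OF prob_space_imp_sigma_finite[OF PP.prob_space_axioms]] R.emeasure_space_1)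
      finally show "emeasure (distr \<Omega> ?P snd) X = emeasure ?P X" .
    qed simp
    also have "distr ?P M (\<lambda>x. x i) = M"
      using PP.PiM_component[of i] i by simp
    finally show ?thesis .
  qed
  then have *: "measure \<Omega> {\<omega>\<in>space \<Omega>. snd \<omega> i \<in> T} = measure M T" if "i < m" for i
    using measure_distr[OF comp[OF that] T] that
    by (simp add: vimage_def Int_def conj_commute)
  have S: "{\<omega>\<in>space \<Omega>. snd \<omega> i \<in> T} \<in> sets \<Omega>" if "i < m" for i
    using measurable_sets[OF comp[OF that] T] by (simp add: vimage_def Int_def conj_commute)
  have U: "{\<omega>\<in>space \<Omega>. \<exists>i<m. snd \<omega> i \<in> T} = (\<Union>i\<in>{..<m}. {\<omega>\<in>space \<Omega>. snd \<omega> i \<in> T})"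
    by auto
  show "{\<omega>\<in>space \<Omega>. \<exists>i<m. snd \<omega> i \<in> T} \<in> sets \<Omega>"
    unfolding U using S by auto
  have "measure \<Omega> {\<omega>\<in>space \<Omega>. \<exists>i<m. snd \<omega> i \<in> T} \<le>
      (\<Sum>i<m. measure \<Omega> {\<omega>\<in>space \<Omega>. snd \<omega> i \<in> T})"
    unfolding U using S by (intro \<Omega>.finite_measure_subadditive_finite) auto
  also have "\<dots> = real m * measure M T" using * by simp
  finally show "measure \<Omega> {\<omega>\<in>space \<Omega>. \<exists>i<m. snd \<omega> i \<in> T} \<le> real m * measure M T" .
qed

lemma (in prob_space) prob_Int4_ge:
  assumes "A \<in> events" "B \<in> events" "C \<in> events" "D \<in> events"
  shows "prob (A \<inter> B \<inter> C \<inter> D) \<ge> prob A + prob B + prob C + prob D - 3"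
proof -
  have *: "prob (X \<inter> Y) \<ge> prob X + prob Y - 1" if "X \<in> events" "Y \<in> events" for X Y
    using finite_measure_Union'[of X Y] finite_measure_Diff'[of Y X] prob_le_1[of "X \<union> Y"] that
    by (simp add: Int_commute)
  show ?thesis
    using *[of A B] *[of "A \<inter> B" C] *[of "A \<inter> B \<inter> C" D] assms by auto
qed

text \<open>On an event where both targets label the whole sample \<open>-1\<close>, the runs for \<open>c v\<close> and
  \<open>c' v\<close> coincide, and soundness for both contradicts \<open>sep\<close> unless some query of the run
  against \<open>M\<close> detects \<open>D v\<close>. The family is finite, so that counting over \<open>v\<close> for each fixed
  outcome needs no measurability of the algorithm in its seed and sample.\<close>

lemma tds_sq_learner_counting:
  fixes M :: "'a measure" and V :: "'v set" and D :: "'v \<Rightarrow> 'a measure"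
    and c c' :: "'v \<Rightarrow> 'a \<Rightarrow> real" and \<kappa> p :: real
  assumes learner: "tds_sq_learner \<C> M \<epsilon> \<delta> m \<phi> R A"
    and queries: "\<And>r S. at_most_queries (A r S) Q"
    and M: "prob_space M" and V: "finite V" and \<phi>: "\<phi> \<ge> 0"
    and D: "\<And>v. v \<in> V \<Longrightarrow> prob_space (D v)" "\<And>v. v \<in> V \<Longrightarrow> sets (D v) = sets M"
    and \<C>: "\<And>v. v \<in> V \<Longrightarrow> c v \<in> \<C>" "\<And>v. v \<in> V \<Longrightarrow> c' v \<in> \<C>"
    and meas: "\<And>v. v \<in> V \<Longrightarrow> c v \<in> borel_measurable M"
      "\<And>v. v \<in> V \<Longrightarrow> c' v \<in> borel_measurable M"
    and sep: "\<And>v. v \<in> V \<Longrightarrow> measure (D v) {z \<in> space M. c v z \<noteq> c' v z} > 2 * \<epsilon>"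
    and rare: "\<And>v. v \<in> V \<Longrightarrow> measure M {z \<in> space M. c v z \<noteq> -1 \<or> c' v z \<noteq> -1} \<le> p"
    and few: "\<And>q. sq_query M q \<Longrightarrow>
      real (card {v\<in>V. \<not> \<bar>(\<integral>x. q x \<partial>M) - (\<integral>x. q x \<partial>D v)\<bar> \<le> \<phi>}) \<le> \<kappa>"
  shows "real (card V) * (1 - 3 * \<delta> - m * p) \<le> Q * \<kappa>"
proof -
  interpret M: prob_space M by fact
  have R: "prob_space R" and wf: "\<And>r S. well_formed M (A r S)"
    using learner by (auto simp: tds_sq_learner_def)
  interpret R: prob_space R by fact
  interpret PP: product_prob_space "\<lambda>_. M" "{..<m}" by unfold_locales
  interpret P: prob_space "\<Pi>\<^sub>M i\<in>{..<m}. M" by (rule PP.prob_space_axioms)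
  define \<Omega> where "\<Omega> = R \<Otimes>\<^sub>M (\<Pi>\<^sub>M i\<in>{..<m}. M)"
  interpret RP: pair_prob_space R "\<Pi>\<^sub>M i\<in>{..<m}. M" by unfold_locales
  interpret \<Omega>: prob_space \<Omega> unfolding \<Omega>_def by unfold_locales
  define bad where "bad v q \<longleftrightarrow> \<not> \<bar>(\<integral>x. q x \<partial>M) - (\<integral>x. q x \<partial>D v)\<bar> \<le> \<phi>" for v :: "'v" and q :: "'a \<Rightarrow> real"
  define orc0 where "orc0 q = (\<integral>x. q x \<partial>M)" for q :: "'a \<Rightarrow> real"
  \<comment> \<open>The tolerance is exploited: the answer is the mean under \<open>M\<close>
    whenever this is allowed, so \<open>orc v\<close> differs from \<open>orc0\<close> only at
    queries that are bad for \<open>v\<close>.\<close>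
  define orc where "orc v q = (if bad v q then (\<integral>x. q x \<partial>D v) else orc0 q)" for v q
  \<comment> \<open>The sample as it looks when all labels are \<open>-1\<close>. The run on it is
    the same for every \<open>v\<close>.\<close>
  define S0 where "S0 x = map (\<lambda>i. (x i, -1 :: real)) [0..<m]" for x :: "nat \<Rightarrow> 'a"
  have oracle0: "sq_oracle M \<phi> orc0" using \<phi> by (simp add: sq_oracle_def orc0_def)
  have orcv: "sq_oracle (D v) \<phi> (orc v)" for v
    using \<phi> by (auto simp: sq_oracle_def orc_def bad_def orc0_def)
  have "\<exists>G\<in>sets \<Omega>. measure \<Omega> G \<ge> 1 - 3 * \<delta> - m * p \<and>
      (\<forall>\<omega>\<in>G. \<exists>q\<in>asked orc0 (A (fst \<omega>) (S0 (snd \<omega>))). bad v q)" if v: "v \<in> V" for v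
  proof -
    interpret D: prob_space "D v" using D v by auto
    have sp: "space (D v) = space M" using D(2)[OF v] by (rule sets_eq_imp_space_eq)
    have succ: "with_prob_at_least \<Omega> (1 - \<delta>)
          (\<lambda>(r, x). \<forall>h. run ora (A r (labeled_sample f m x)) = Some h \<longrightarrow>
             measure D' {z \<in> space D'. f z \<noteq> h z} \<le> \<epsilon>)"
      "D' = M \<Longrightarrow> with_prob_at_least \<Omega> (1 - \<delta>)
             (\<lambda>(r, x). run ora (A r (labeled_sample f m x)) \<noteq> None)"
      if "f \<in> \<C>" "prob_space D'" "sets D' = sets M" "sq_oracle D' \<phi> ora" for f D' ora
      using learner that unfolding tds_sq_learner_def \<Omega>_def by simp_all
    obtain E1 where E1: "E1 \<in> sets \<Omega>" "measure \<Omega> E1 \<ge> 1 - \<delta>"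
      "\<And>r x h. (r, x) \<in> E1 \<Longrightarrow> run (orc v) (A r (labeled_sample (c v) m x)) = Some h \<Longrightarrow>
             measure (D v) {z \<in> space (D v). c v z \<noteq> h z} \<le> \<epsilon>"
      using succ(1)[OF \<C>(1)[OF v] D(1)[OF v] D(2)[OF v] orcv]
      unfolding with_prob_at_least_def by fast
    obtain E2 where E2: "E2 \<in> sets \<Omega>" "measure \<Omega> E2 \<ge> 1 - \<delta>"
      "\<And>r x h. (r, x) \<in> E2 \<Longrightarrow> run (orc v) (A r (labeled_sample (c' v) m x)) = Some h \<Longrightarrow>
             measure (D v) {z \<in> space (D v). c' v z \<noteq> h z} \<le> \<epsilon>"
      using succ(1)[OF \<C>(2)[OF v] D(1)[OF v] D(2)[OF v] orcv]
      unfolding with_prob_at_least_def by fast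
    \<comment> \<open>Completeness is invoked for \<open>M\<close> with its exact oracle; the
      accepting run is later transferred to \<open>orc v\<close>.\<close>
    obtain E3 where E3: "E3 \<in> sets \<Omega>" "measure \<Omega> E3 \<ge> 1 - \<delta>"
      "\<And>r x. (r, x) \<in> E3 \<Longrightarrow> run orc0 (A r (labeled_sample (c v) m x)) \<noteq> None"
      using succ(2)[OF \<C>(1)[OF v] M refl oracle0 refl]
      unfolding with_prob_at_least_def by fast
    define T where "T = {z \<in> space M. c v z \<noteq> -1 \<or> c' v z \<noteq> -1}"
    have T: "T \<in> sets M" unfolding T_def using meas[OF v] by measurable
    define U where "U = {\<omega>\<in>space \<Omega>. \<exists>i<m. snd \<omega> i \<in> T}"
    have U: "U \<in> sets \<Omega>" "measure \<Omega> U \<le> m * measure M T"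
      using prob_some_component_le[OF M R T, of m] unfolding U_def \<Omega>_def by blast+
    have "m * measure M T \<le> m * p" using rare[OF v] by (simp add: T_def mult_left_mono)
    then have Uc: "measure \<Omega> (space \<Omega> - U) \<ge> 1 - m * p"
      using U \<Omega>.prob_compl[OF U(1)] by linarith
    define G where "G = E1 \<inter> E2 \<inter> E3 \<inter> (space \<Omega> - U)"
    have "G \<in> sets \<Omega>" unfolding G_def using E1 E2 E3 U by auto
    moreover have "measure \<Omega> G \<ge> 1 - 3 * \<delta> - m * p"
      using \<Omega>.prob_Int4_ge[of E1 E2 E3 "space \<Omega> - U"] E1 E2 E3 U Uc by (auto simp: G_def)
    moreover have "\<exists>q\<in>asked orc0 (A (fst \<omega>) (S0 (snd \<omega>))). bad v q" if \<omega>: "\<omega> \<in> G" for \<omega>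
    proof (rule ccontr)
      assume neg: "\<not> ?thesis"
      obtain r x where rx: "\<omega> = (r, x)" by (cases \<omega>)
      have xs: "x i \<in> space M" if "i < m" for i
        using \<omega> that by (auto simp: G_def \<Omega>_def rx space_pair_measure space_PiM)
      have lab: "c v (x i) = -1" "c' v (x i) = -1" if "i < m" for i
        using \<omega> that xs[OF that] by (auto simp: G_def U_def T_def rx)
      have S: "labeled_sample (c v) m x = S0 x" "labeled_sample (c' v) m x = S0 x"
        using lab by (auto simp: labeled_sample_def S0_def)
      have eq: "run (orc v) (A r (S0 x)) = run orc0 (A r (S0 x))"
        using neg by (intro run_cong_asked) (auto simp: orc_def rx)
      obtain h where h: "run orc0 (A r (S0 x)) = Some h"
        using E3(3)[of r x] \<omega> by (auto simp: G_def rx S)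
      note [measurable] = run_measurable[OF wf h]
      have [measurable]: "h \<in> borel_measurable (D v)" "c v \<in> borel_measurable (D v)"
        "c' v \<in> borel_measurable (D v)"
        using meas[OF v] D(2)[OF v] by (auto cong: measurable_cong_sets)
      have ev: "{z \<in> space (D v). c v z \<noteq> h z} \<in> sets (D v)"
        "{z \<in> space (D v). c' v z \<noteq> h z} \<in> sets (D v)"
        by measurable
      \<comment> \<open>Wherever the two targets differ, any \<open>h\<close> disagrees with at
        least one of them.\<close>
      have "measure (D v) {z \<in> space M. c v z \<noteq> c' v z} \<le>
        measure (D v) ({z \<in> space (D v). c v z \<noteq> h z} \<union> {z \<in> space (D v). c' v z \<noteq> h z})"
        using ev by (intro D.finite_measure_mono sets.Un) (auto simp: sp)
      also have "\<dots> \<le> measure (D v) {z \<in> space (D v). c v z \<noteq> h z} +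
          measure (D v) {z \<in> space (D v). c' v z \<noteq> h z}"
        using ev by (intro measure_Un_le) auto
      also have "\<dots> \<le> \<epsilon> + \<epsilon>"
        using E1(3)[of r x h] E2(3)[of r x h] \<omega> h eq by (auto simp: G_def rx S)
      finally show False using sep[OF v] by simp
    qed
    ultimately show ?thesis by blast
  qed
  then obtain G where G: "\<And>v. v \<in> V \<Longrightarrow> G v \<in> sets \<Omega>"
    "\<And>v. v \<in> V \<Longrightarrow> measure \<Omega> (G v) \<ge> 1 - 3 * \<delta> - m * p"
    "\<And>v \<omega>. v \<in> V \<Longrightarrow> \<omega> \<in> G v \<Longrightarrow> \<exists>q\<in>asked orc0 (A (fst \<omega>) (S0 (snd \<omega>))). bad v q"
    by metis
  \<comment> \<open>\<open>few\<close> bounds a cardinality by \<open>\<kappa>\<close> for every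
    admissible query, for instance the zero query.\<close>
  have \<kappa>: "0 \<le> \<kappa>"
    using few[of "\<lambda>_. 0"] by (rule order_trans[OF of_nat_0_le_iff]) (auto simp: sq_query_def)
  \<comment> \<open>For a fixed outcome, every \<open>v\<close> counted is detected by one of at
    most \<open>Q\<close> asked queries, and each query detects at most \<open>\<kappa>\<close>
    elements.\<close>
  have pointwise: "(\<Sum>v\<in>V. indicat_real (G v) \<omega>) \<le> Q * \<kappa>" for \<omega>
  proof -
    let ?As = "asked orc0 (A (fst \<omega>) (S0 (snd \<omega>)))"
    have As: "finite ?As" "card ?As \<le> Q" using card_asked[OF queries] by auto
    have "(\<Sum>v\<in>V. indicat_real (G v) \<omega>) = real (card {v\<in>V. \<omega> \<in> G v})"
      using V by (simp add: indicator_def sum.If_cases Int_def)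
    also have "card {v\<in>V. \<omega> \<in> G v} \<le> card (\<Union>q\<in>?As. {v\<in>V. bad v q})"
      using G(3) V As by (intro card_mono) auto
    also have "\<dots> \<le> (\<Sum>q\<in>?As. card {v\<in>V. bad v q})"
      using As by (intro card_UN_le) auto
    also have "real \<dots> \<le> (\<Sum>q\<in>?As. \<kappa>)"
      unfolding of_nat_sum bad_def using sq_query_asked[OF wf] by (intro sum_mono few) auto
    also have "\<dots> \<le> Q * \<kappa>" using As \<kappa> by (simp add: mult_right_mono)
    finally show ?thesis by simp
  qed
  \<comment> \<open>Averaging over the outcomes: the events \<open>G v\<close> are measurable, so
    sum and integral can be exchanged.\<close>
  have "real (card V) * (1 - 3 * \<delta> - m * p) = (\<Sum>v\<in>V. 1 - 3 * \<delta> - m * p)" by simp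
  also have "\<dots> \<le> (\<Sum>v\<in>V. measure \<Omega> (G v))" using G by (intro sum_mono) auto
  also have "\<dots> = (\<Sum>v\<in>V. (\<integral>\<omega>. indicat_real (G v) \<omega> \<partial>\<Omega>))"
    using G by (intro sum.cong) auto
  also have "\<dots> = (\<integral>\<omega>. (\<Sum>v\<in>V. indicat_real (G v) \<omega>) \<partial>\<Omega>)"
    using G by (subst Bochner_Integration.integral_sum) (auto intro!: \<Omega>.integrable_const_bound[of _ 1] simp: less_top[symmetric])
  also have "\<dots> \<le> Q * \<kappa>"
    using G pointwise by (intro \<Omega>.integral_le_const AE_I2 Bochner_Integration.integrable_sum) (auto simp: less_top[symmetric])
  finally show ?thesis .
qed

subsection \<open>Statistical queries and pairwise correlations\<close>

text \<open>Cauchy-Schwarz against the sum \<open>F\<close> of the family: as \<open>q\<close> is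
  bounded by 1, the squared mean of \<open>q x * F x\<close> is at most the second moment of
  \<open>F\<close>, which expands into all pairwise correlations.\<close>

lemma (in prob_space) sum_correlations_ge:
  fixes f :: "'v \<Rightarrow> 'a \<Rightarrow> real"
  assumes B: "finite B"
    and f: "\<And>v. v \<in> B \<Longrightarrow> f v \<in> borel_measurable M"
    and int: "\<And>v w. v \<in> B \<Longrightarrow> w \<in> B \<Longrightarrow> integrable M (\<lambda>x. f v x * f w x)"
    and q: "q \<in> borel_measurable M" "\<And>x. x \<in> space M \<Longrightarrow> \<bar>q x\<bar> \<le> 1"
    and corr: "\<And>v. v \<in> B \<Longrightarrow> (\<integral>x. q x * f v x \<partial>M) \<ge> \<phi>" and \<phi>: "\<phi> \<ge> 0"
  shows "(real (card B) * \<phi>)\<^sup>2 \<le> (\<Sum>v\<in>B. \<Sum>w\<in>B. (\<integral>x. f v x * f w x \<partial>M))"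
proof -
  define F where "F x = (\<Sum>v\<in>B. f v x)" for x
  have [measurable]: "F \<in> borel_measurable M" unfolding F_def using f by (intro borel_measurable_sum) auto
  note [measurable] = q(1)
  have F2: "(F x)\<^sup>2 = (\<Sum>v\<in>B. \<Sum>w\<in>B. f v x * f w x)" for x
    by (simp add: F_def power2_eq_square sum_product)
  have intF2: "integrable M (\<lambda>x. (F x)\<^sup>2)"
    unfolding F2 using int by (intro Bochner_Integration.integrable_sum) auto
  have q2: "(q x * F x)\<^sup>2 \<le> (F x)\<^sup>2" if "x \<in> space M" for x
    using q(2)[OF that] by (simp add: power_mult_distrib mult_left_le_one_le abs_square_le_1)
  have int2: "integrable M (\<lambda>x. (q x * F x)\<^sup>2)"
    by (rule Bochner_Integration.integrable_bound[OF intF2]) (simp_all add: q2)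
  have int1: "integrable M (\<lambda>x. q x * F x)"
    by (rule square_integrable_imp_integrable[OF _ int2]) simp
  have intf: "integrable M (\<lambda>x. q x * f v x)" if "v \<in> B" for v
  proof (rule Bochner_Integration.integrable_bound)
    show "integrable M (f v)"
      by (rule square_integrable_imp_integrable[OF f[OF that]])
         (simp add: power2_eq_square int[OF that that])
    show "AE x in M. norm (q x * f v x) \<le> norm (f v x)"
      using q(2) by (intro AE_I2) (simp add: abs_mult mult_left_le_one_le)
    show "(\<lambda>x. q x * f v x) \<in> borel_measurable M"
      using f[OF that] by measurable
  qed
  have "real (card B) * \<phi> = (\<Sum>v\<in>B. \<phi>)" by simp
  also have "\<dots> \<le> (\<Sum>v\<in>B. (\<integral>x. q x * f v x \<partial>M))" using corr by (rule sum_mono)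
  also have "\<dots> = (\<integral>x. q x * F x \<partial>M)"
    using intf by (simp add: F_def sum_distrib_left)
  finally have "(real (card B) * \<phi>)\<^sup>2 \<le> (\<integral>x. q x * F x \<partial>M)\<^sup>2"
    using \<phi> by (intro power_mono) auto
  also have "\<dots> \<le> (\<integral>x. (q x * F x)\<^sup>2 \<partial>M)"
    \<comment> \<open>The inequality is the nonnegativity of the variance of
      \<open>q x * F x\<close>.\<close>
    using variance_eq[OF int1 int2] variance_positive[of "\<lambda>x. q x * F x"] by linarith
  also have "\<dots> \<le> (\<integral>x. (F x)\<^sup>2 \<partial>M)"
    using q2 by (intro integral_mono int2 intF2)
  also have "\<dots> = (\<Sum>v\<in>B. \<Sum>w\<in>B. (\<integral>x. f v x * f w x \<partial>M))"
    unfolding F2 using int by (subst Bochner_Integration.integral_sum) (auto intro!: sum.cong Bochner_Integration.integral_sum)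
  finally show ?thesis .
qed

text \<open>If \<open>b\<close> elements have correlation at least \<open>\<phi>\<close> with
  \<open>q\<close>, the previous bound gives \<open>b\<^sup>2 * \<phi>\<^sup>2 \<le> b\<^sup>2 *
  \<gamma> + b * N * K\<close>, and the first term on the right is absorbed because it is at most
  half of the left side. Absorption costs a factor 2, and treating \<open>q\<close> and
  \<open>- q\<close> separately another 2.\<close>

lemma (in prob_space) card_correlated_le:
  fixes f :: "'v \<Rightarrow> 'a \<Rightarrow> real"
  assumes V: "finite V"
    and f: "\<And>v. v \<in> V \<Longrightarrow> f v \<in> borel_measurable M"
    and int: "\<And>v w. v \<in> V \<Longrightarrow> w \<in> V \<Longrightarrow> integrable M (\<lambda>x. f v x * f w x)"
    and close: "\<And>v. v \<in> V \<Longrightarrow> real (card {w\<in>V. close v w}) \<le> N"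
    and far: "\<And>v w. v \<in> V \<Longrightarrow> w \<in> V \<Longrightarrow> \<not> close v w \<Longrightarrow> (\<integral>x. f v x * f w x \<partial>M) \<le> \<gamma>"
    and K: "\<And>v w. v \<in> V \<Longrightarrow> w \<in> V \<Longrightarrow> (\<integral>x. f v x * f w x \<partial>M) \<le> K"
    and nonneg: "0 \<le> N" "0 \<le> K" "0 \<le> \<gamma>" and \<phi>: "\<phi> > 0" "2 * \<gamma> \<le> \<phi>\<^sup>2"
    and q: "q \<in> borel_measurable M" "\<And>x. x \<in> space M \<Longrightarrow> \<bar>q x\<bar> \<le> 1"
  shows "real (card {v\<in>V. \<not> \<bar>\<integral>x. q x * f v x \<partial>M\<bar> \<le> \<phi>}) \<le> 4 * N * K / \<phi>\<^sup>2"
proof -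
  have one: "real (card {v\<in>V. (\<integral>x. q x * f v x \<partial>M) \<ge> \<phi>}) \<le> 2 * N * K / \<phi>\<^sup>2"
    if q: "q \<in> borel_measurable M" "\<And>x. x \<in> space M \<Longrightarrow> \<bar>q x\<bar> \<le> 1" for q
  proof -
    define B where "B = {v\<in>V. (\<integral>x. q x * f v x \<partial>M) \<ge> \<phi>}"
    define b where "b = real (card B)"
    have B: "finite B" "B \<subseteq> V" using V by (auto simp: B_def)
    have "(b * \<phi>)\<^sup>2 \<le> (\<Sum>v\<in>B. \<Sum>w\<in>B. (\<integral>x. f v x * f w x \<partial>M))"
      unfolding b_def using B \<phi> q
      by (intro sum_correlations_ge[of B f q]) (auto simp: B_def intro!: f int)
    also have "\<dots> \<le> (\<Sum>v\<in>B. \<Sum>w\<in>B. \<gamma> + (if close v w then K else 0))"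
    proof (intro sum_mono)
      fix v w assume "v \<in> B" "w \<in> B"
      then have "v \<in> V" "w \<in> V" using B by auto
      then show "(\<integral>x. f v x * f w x \<partial>M) \<le> \<gamma> + (if close v w then K else 0)"
        using far[of v w] K[of v w] nonneg by (cases "close v w") auto
    qed
    also have "\<dots> \<le> (\<Sum>v\<in>B. b * \<gamma> + N * K)"
    proof (intro sum_mono)
      fix v assume v: "v \<in> B"
      have "real (card {w\<in>B. close v w}) \<le> real (card {w\<in>V. close v w})"
        using B V by (intro of_nat_mono card_mono) auto
      also have "\<dots> \<le> N" using close v B by auto
      finally have "real (card {w\<in>B. close v w}) * K \<le> N * K"
        using nonneg by (intro mult_right_mono)
      moreover have "(\<Sum>w\<in>B. if close v w then K else 0) = real (card {w\<in>B. close v w}) * K"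
        using B by (simp add: sum.If_cases Int_def)
      ultimately show "(\<Sum>w\<in>B. \<gamma> + (if close v w then K else 0)) \<le> b * \<gamma> + N * K"
        by (simp add: sum.distrib b_def)
    qed
    also have "\<dots> = b * (b * \<gamma> + N * K)" by (simp add: b_def)
    finally have *: "b * (b * \<phi>\<^sup>2) \<le> b * (b * \<gamma> + N * K)"
      by (simp add: power_mult_distrib power2_eq_square algebra_simps)
    have "b * \<phi>\<^sup>2 \<le> 2 * N * K"
    proof (cases "b > 0")
      case True
      then have "b * \<phi>\<^sup>2 \<le> b * \<gamma> + N * K" using * by simp
      moreover have "b * (2 * \<gamma>) \<le> b * \<phi>\<^sup>2" using \<phi> True by (intro mult_left_mono) auto
      ultimately show ?thesis by linarith
    next
      case False
      then show ?thesis using nonneg by (simp add: b_def)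
    qed
    then show ?thesis using \<phi> by (simp add: b_def B_def field_simps)
  qed
  let ?B = "\<lambda>q. {v\<in>V. (\<integral>x. q x * f v x \<partial>M) \<ge> \<phi>}"
  have "card {v\<in>V. \<not> \<bar>\<integral>x. q x * f v x \<partial>M\<bar> \<le> \<phi>} \<le> card (?B q \<union> ?B (\<lambda>x. - q x))"
    using V by (intro card_mono) auto
  also have "\<dots> \<le> card (?B q) + card (?B (\<lambda>x. - q x))" by (rule card_Un_le)
  finally have "real (card {v\<in>V. \<not> \<bar>\<integral>x. q x * f v x \<partial>M\<bar> \<le> \<phi>}) \<le>
      real (card (?B q)) + real (card (?B (\<lambda>x. - q x)))" by linarith
  also have "\<dots> \<le> 2 * N * K / \<phi>\<^sup>2 + 2 * N * K / \<phi>\<^sup>2"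
    using q by (intro add_mono one) auto
  finally show ?thesis by (simp add: mult_ac)
qed

section \<open>Concentration of inner products of sign vectors\<close>

text \<open>The power series are compared term by term, which reduces to
  \<open>2 ^ n * fact n \<le> fact (2 * n)\<close>.\<close>

lemma cosh_le_exp_half_square: "cosh s \<le> exp (s\<^sup>2 / 2)" for s :: real
proof (rule sums_le)
  let ?f = "\<lambda>n. if even n then s ^ n /\<^sub>R fact n else 0"
  \<comment> \<open>The odd terms vanish, so the series of \<open>cosh\<close> can be re-indexed by
    even exponents.\<close>
  have "?f n = 0" if "n \<notin> range (\<lambda>n. 2 * n)" for n using that by (auto elim!: evenE)
  then have "(\<lambda>n. ?f (2 * n)) sums cosh s \<longleftrightarrow> ?f sums cosh s"
    by (intro sums_mono_reindex) (simp_all add: strict_mono_def)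
  then show "(\<lambda>n. s ^ (2 * n) /\<^sub>R fact (2 * n)) sums cosh s"
    using cosh_converges[of s] by simp
  show "(\<lambda>n. (s\<^sup>2 / 2) ^ n /\<^sub>R fact n) sums exp (s\<^sup>2 / 2)" by (rule exp_converges)
  fix n :: nat
  have "(2 :: real) ^ n * fact n \<le> fact (2 * n)"
  proof (induction n)
    case (Suc n)
    have "(2 :: real) ^ Suc n * fact (Suc n) = (2 * (real n + 1)) * (2 ^ n * fact n)"
      by (simp add: algebra_simps)
    also have "\<dots> \<le> ((2 * real n + 2) * (2 * real n + 1)) * fact (2 * n)"
      using Suc by (intro mult_mono) (auto intro: mult_mono simp: algebra_simps)
    also have "\<dots> = fact (2 * Suc n)" by (simp add: algebra_simps)
    finally show ?case .
  qed simp
  then have "s ^ (2 * n) / fact (2 * n) \<le> s ^ (2 * n) / (2 ^ n * fact n)"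
    by (intro divide_left_mono) (auto simp: power_mult)
  also have "\<dots> = (s\<^sup>2 / 2) ^ n / fact n"
    by (simp add: power_mult power_divide)
  finally show "s ^ (2 * n) /\<^sub>R fact (2 * n) \<le> (s\<^sup>2 / 2) ^ n /\<^sub>R fact n"
    by (simp only: real_scaleR_def divide_inverse_commute)
qed

text \<open>A finite substitute for the sphere: divided by \<open>sqrt d\<close> these are unit
  vectors, and probabilities over directions become counts.\<close>

definition sign_vectors :: "nat \<Rightarrow> (nat \<Rightarrow> real) set" where
  "sign_vectors d = {..<d} \<rightarrow>\<^sub>E {-1, 1}"

lemma finite_sign_vectors: "finite (sign_vectors d)"
  and card_sign_vectors: "card (sign_vectors d) = 2 ^ d"
  by (auto simp: sign_vectors_def card_PiE numeral_2_eq_2 intro!: finite_PiE)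

text \<open>Hoeffding's inequality in counting form. For fixed \<open>v\<close> the products
  \<open>v i * w i\<close> range over all sign patterns, so the exponential sum factors into a power
  of \<open>cosh\<close>.\<close>

lemma sign_vectors_correlated_le:
  assumes v: "v \<in> sign_vectors d" and \<eta>: "\<eta> \<ge> 0"
  shows "real (card {w\<in>sign_vectors d. \<bar>\<Sum>i<d. v i * w i\<bar> > real d * \<eta>}) \<le>
    2 * 2 ^ d * exp (- (real d * \<eta>\<^sup>2 / 2))"
proof -
  let ?S = "\<lambda>w. \<Sum>i<d. v i * w i" and ?V = "sign_vectors d"
  have mgf: "(\<Sum>w\<in>?V. exp (s * ?S w)) \<le> 2 ^ d * exp (real d * s\<^sup>2 / 2)" for s
  proof -
    have "(\<Sum>w\<in>?V. exp (s * ?S w)) = (\<Sum>w\<in>?V. \<Prod>i<d. exp (s * v i * w i))"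
      by (simp add: sum_distrib_left exp_sum mult.assoc)
    also have "\<dots> = (\<Prod>i<d. \<Sum>a\<in>{-1,1}. exp (s * v i * a))"
      unfolding sign_vectors_def by (subst prod_sum_PiE) auto
    also have "\<dots> = (\<Prod>i<d. 2 * cosh s)"
    proof (intro prod.cong refl)
      fix i assume "i \<in> {..<d}"
      then have "v i = -1 \<or> v i = 1" using v by (auto simp: sign_vectors_def PiE_iff)
      then show "(\<Sum>a\<in>{-1,1}. exp (s * v i * a)) = 2 * cosh s" by (auto simp: cosh_def)
    qed
    also have "\<dots> = 2 ^ d * cosh s ^ d" by (simp add: power_mult_distrib)
    also have "\<dots> \<le> 2 ^ d * exp (s\<^sup>2 / 2) ^ d"
      by (intro mult_left_mono power_mono cosh_le_exp_half_square) auto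
    also have "\<dots> = 2 ^ d * exp (real d * s\<^sup>2 / 2)"
      by (simp add: exp_of_nat_mult[symmetric])
    finally show ?thesis .
  qed
  have "real (card {w\<in>?V. \<bar>?S w\<bar> > real d * \<eta>}) =
      (\<Sum>w\<in>?V. if \<bar>?S w\<bar> > real d * \<eta> then 1 else 0)"
    using finite_sign_vectors by (simp add: sum.If_cases Int_def)
  \<comment> \<open>Markov's inequality with exponent \<open>\<eta>\<close>, the minimiser of
    \<open>d * s\<^sup>2 / 2 - s * d * \<eta>\<close> over \<open>s\<close>.\<close>
  also have "\<dots> \<le> (\<Sum>w\<in>?V. exp (- (real d * \<eta>\<^sup>2)) * (exp (\<eta> * ?S w) + exp (- \<eta> * ?S w)))"
  proof (intro sum_mono)
    fix w
    have "1 \<le> exp (- (real d * \<eta>\<^sup>2)) * exp (\<eta> * \<bar>?S w\<bar>)" if "\<bar>?S w\<bar> > real d * \<eta>"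
      using mult_left_mono[OF less_imp_le[OF that] \<eta>]
      by (simp add: exp_add[symmetric] power2_eq_square algebra_simps)
    moreover have "exp (\<eta> * \<bar>?S w\<bar>) \<le> exp (\<eta> * ?S w) + exp (- \<eta> * ?S w)"
      by (cases "?S w \<ge> 0") auto
    then have "exp (- (real d * \<eta>\<^sup>2)) * exp (\<eta> * \<bar>?S w\<bar>) \<le>
        exp (- (real d * \<eta>\<^sup>2)) * (exp (\<eta> * ?S w) + exp (- \<eta> * ?S w))"
      by (intro mult_left_mono) auto
    ultimately show "(if \<bar>?S w\<bar> > real d * \<eta> then 1 else 0) \<le>
        exp (- (real d * \<eta>\<^sup>2)) * (exp (\<eta> * ?S w) + exp (- \<eta> * ?S w))"
      by (auto intro: order_trans)
  qed
  also have "\<dots> = exp (- (real d * \<eta>\<^sup>2)) *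
      ((\<Sum>w\<in>?V. exp (\<eta> * ?S w)) + (\<Sum>w\<in>?V. exp (- \<eta> * ?S w)))"
    unfolding sum.distrib[symmetric] sum_distrib_left ..
  also have "\<dots> \<le> exp (- (real d * \<eta>\<^sup>2)) *
      (2 ^ d * exp (real d * \<eta>\<^sup>2 / 2) + 2 ^ d * exp (real d * (- \<eta>)\<^sup>2 / 2))"
    by (intro mult_left_mono add_mono mgf) auto
  also have "\<dots> = 2 * 2 ^ d * exp (- (real d * \<eta>\<^sup>2) + real d * \<eta>\<^sup>2 / 2)"
    unfolding exp_add power2_minus by (simp only: mult_ac mult_2_right[symmetric] mult_2[symmetric])
  also have "- (real d * \<eta>\<^sup>2) + real d * \<eta>\<^sup>2 / 2 = - (real d * \<eta>\<^sup>2 / 2)"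
    by simp
  finally show ?thesis .
qed

subsection \<open>Signed measures on the line with vanishing moments\<close>

text \<open>For fixed \<open>x\<close>, as a function of \<open>a\<close>, these are the weights of
  a signed measure on \<open>S\<close> with the same low moments as the unit mass at
  \<open>x\<close>.\<close>

definition lagrange_weight :: "real set \<Rightarrow> real \<Rightarrow> real \<Rightarrow> real" where
  "lagrange_weight S a x = (\<Prod>b\<in>S - {a}. (x - b) / (a - b))"

text \<open>Interpolation of a monomial of degree \<open>j\<close> is exact: interpolant and
  monomial both have degree below \<open>card S\<close> and agree on \<open>S\<close>.\<close>

lemma lagrange_weight_moment:
  assumes S: "finite S" and j: "j < card S"
  shows "(\<Sum>a\<in>S. lagrange_weight S a x * a ^ j) = x ^ j"
proof -
  define l where "l a = (\<Prod>b\<in>S - {a}. smult (1 / (a - b)) [:- b, 1:])" for a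
  have l: "poly (l a) y = lagrange_weight S a y" for a y
    by (simp add: l_def lagrange_weight_def poly_prod algebra_simps diff_divide_distrib)
  have deg_l: "degree (l a) < card S" if "a \<in> S" for a
  proof -
    have "degree (l a) \<le> (\<Sum>b\<in>S - {a}. degree (smult (1 / (a - b)) [:- b, 1:]))"
      using S unfolding l_def by (intro order_trans[OF degree_prod_sum_le]) auto
    also have "\<dots> \<le> (\<Sum>b\<in>S - {a}. 1)" by (intro sum_mono) auto
    also have "\<dots> < card S" using S that card_gt_0_iff[of S] by auto
    finally show ?thesis .
  qed
  define p where "p = (\<Sum>a\<in>S. smult (a ^ j) (l a))"
  have "p = monom 1 j"
  proof (rule poly_eqI_degree)
    fix y assume y: "y \<in> S"
    have "lagrange_weight S a y = (if a = y then 1 else 0)" if "a \<in> S" for a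
      using S y that by (auto simp: lagrange_weight_def intro!: prod.neutral)
    then have "(\<Sum>a\<in>S. a ^ j * lagrange_weight S a y) = (\<Sum>a\<in>S. if a = y then y ^ j else 0)"
      by (intro sum.cong) auto
    then show "poly p y = poly (monom 1 j) y"
      using S y by (simp add: p_def poly_sum l poly_monom)
  next
    show "card S > degree p"
      unfolding p_def using S j deg_l
      by (intro degree_sum_less) (auto intro: order_le_less_trans[OF degree_smult_le])
    show "card S > degree (monom (1::real) j)"
      using j by (simp add: degree_monom_eq)
  qed
  then have "poly p x = x ^ j" by (simp add: poly_monom)
  then show ?thesis by (simp add: p_def poly_sum l mult.commute)
qed

text \<open>Lagrange form of the remainder, with the factor \<open>1 / fact n\<close>
  discarded.\<close>

lemma exp_minus_taylor_le:
  "\<bar>exp x - (\<Sum>m<n. x ^ m / fact m)\<bar> \<le> \<bar>x\<bar> ^ n * exp \<bar>x\<bar>" for x :: real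
proof -
  obtain t where t: "\<bar>t\<bar> \<le> \<bar>x\<bar>" "exp x = (\<Sum>m<n. x ^ m / fact m) + exp t / fact n * x ^ n"
    using Maclaurin_exp_le by blast
  have "\<bar>exp t / fact n * x ^ n\<bar> = \<bar>x\<bar> ^ n * (exp t / fact n)"
    by (simp add: abs_mult power_abs)
  also have "\<dots> \<le> \<bar>x\<bar> ^ n * (exp \<bar>x\<bar> / 1)"
    using t(1) fact_ge_1[of n] by (intro mult_left_mono frac_le) auto
  finally show ?thesis using t(2) by simp
qed

text \<open>The vanishing moments remove the Taylor terms of order below \<open>n\<close>.\<close>

lemma exp_correlation_le:
  fixes c :: "real \<Rightarrow> real"
  assumes \<Lambda>: "finite \<Lambda>" "\<And>a. a \<in> \<Lambda> \<Longrightarrow> \<bar>a\<bar> \<le> \<tau>"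
    and moments: "\<And>j. j < n \<Longrightarrow> (\<Sum>a\<in>\<Lambda>. c a * a ^ j) = 0"
    and \<rho>: "\<bar>\<rho>\<bar> \<le> r"
  shows "\<bar>\<Sum>a\<in>\<Lambda>. \<Sum>b\<in>\<Lambda>. c a * c b * exp (a * b * \<rho>)\<bar> \<le>
    (\<Sum>a\<in>\<Lambda>. \<bar>c a\<bar>)\<^sup>2 * ((r * \<tau>\<^sup>2) ^ n * exp (r * \<tau>\<^sup>2))"
proof -
  define T where "T x = (\<Sum>m<n. x ^ m / fact m)" for x :: real
  have "(\<Sum>a\<in>\<Lambda>. \<Sum>b\<in>\<Lambda>. c a * c b * T (a * b * \<rho>)) =
      (\<Sum>a\<in>\<Lambda>. \<Sum>b\<in>\<Lambda>. \<Sum>m<n. (c a * a ^ m) * (c b * b ^ m) * (\<rho> ^ m / fact m))"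
    by (simp add: T_def sum_distrib_left power_mult_distrib mult_ac)
  \<comment> \<open>Taylor term \<open>m\<close> now factors into the product of two moments of
    order \<open>m\<close>, both zero.\<close>
  also have "\<dots> = (\<Sum>m<n. (\<Sum>a\<in>\<Lambda>. \<Sum>b\<in>\<Lambda>. (c a * a ^ m) * (c b * b ^ m)) * (\<rho> ^ m / fact m))"
    unfolding sum_distrib_right by (simp only: sum.swap[where A = \<Lambda> and B = "{..<n}"])
  also have "\<dots> = 0"
    by (simp add: sum_product[symmetric] moments)
  finally have 0: "(\<Sum>a\<in>\<Lambda>. \<Sum>b\<in>\<Lambda>. c a * c b * T (a * b * \<rho>)) = 0" .
  have "(\<Sum>a\<in>\<Lambda>. \<Sum>b\<in>\<Lambda>. c a * c b * exp (a * b * \<rho>)) =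
      (\<Sum>a\<in>\<Lambda>. \<Sum>b\<in>\<Lambda>. c a * c b * (exp (a * b * \<rho>) - T (a * b * \<rho>)))"
    (is "?l = ?r")
    using 0 by (simp add: right_diff_distrib sum_subtractf)
  then have "\<bar>?l\<bar> = \<bar>?r\<bar>" by simp
  also have "\<bar>?r\<bar> \<le> (\<Sum>a\<in>\<Lambda>. \<Sum>b\<in>\<Lambda>. \<bar>c a * c b * (exp (a * b * \<rho>) - T (a * b * \<rho>))\<bar>)"
    by (rule order_trans[OF sum_abs sum_mono[OF sum_abs]])
  also have "\<dots> \<le> (\<Sum>a\<in>\<Lambda>. \<Sum>b\<in>\<Lambda>. \<bar>c a\<bar> * \<bar>c b\<bar> * ((r * \<tau>\<^sup>2) ^ n * exp (r * \<tau>\<^sup>2)))"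
  proof (intro sum_mono)
    fix a b assume ab: "a \<in> \<Lambda>" "b \<in> \<Lambda>"
    have "\<bar>a * b\<bar> \<le> \<tau>\<^sup>2"
      unfolding abs_mult power2_eq_square using \<Lambda>(2)[OF ab(1)] \<Lambda>(2)[OF ab(2)]
      by (intro mult_mono) auto
    then have *: "\<bar>a * b * \<rho>\<bar> \<le> r * \<tau>\<^sup>2"
      using \<rho> unfolding abs_mult[of "a * b"] by (subst mult.commute) (intro mult_mono, auto)
    have "\<bar>exp (a * b * \<rho>) - T (a * b * \<rho>)\<bar> \<le> \<bar>a * b * \<rho>\<bar> ^ n * exp \<bar>a * b * \<rho>\<bar>"
      unfolding T_def by (rule exp_minus_taylor_le)
    also have "\<dots> \<le> (r * \<tau>\<^sup>2) ^ n * exp (r * \<tau>\<^sup>2)"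
      using * by (intro mult_mono power_mono) auto
    finally show "\<bar>c a * c b * (exp (a * b * \<rho>) - T (a * b * \<rho>))\<bar> \<le>
        \<bar>c a\<bar> * \<bar>c b\<bar> * ((r * \<tau>\<^sup>2) ^ n * exp (r * \<tau>\<^sup>2))"
      unfolding abs_mult by (intro mult_left_mono) auto
  qed
  also have "\<dots> = (\<Sum>a\<in>\<Lambda>. \<bar>c a\<bar>)\<^sup>2 * ((r * \<tau>\<^sup>2) ^ n * exp (r * \<tau>\<^sup>2))"
    by (subst power2_eq_square[of "\<Sum>a\<in>\<Lambda>. \<bar>c a\<bar>"], subst sum_product, subst sum_distrib_right)
       (intro sum.cong refl sum_distrib_right[symmetric])
  finally show ?thesis .
qed

section \<open>Equally spaced nodes and the one-dimensional perturbation\<close>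

text \<open>The inner nodes stay in [0, 1) so that their tilts grow at most like
  \<open>exp \<bar>t\<bar>\<close>, and their spacing \<open>1 / n\<close> controls the denominators
  of the Lagrange weights.\<close>

definition grid :: "nat \<Rightarrow> real set" where
  "grid n = (\<lambda>i. real i / real n) ` {..<n}"

lemma finite_grid: "finite (grid n)"
  by (simp add: grid_def)

lemma card_grid: "card (grid n) = n"
proof (cases "n = 0")
  case False
  then show ?thesis unfolding grid_def by (subst card_image) (auto simp: inj_on_def)
qed (simp add: grid_def)

lemma grid_bounds: "a \<in> grid n \<Longrightarrow> 0 \<le> a \<and> a < 1"
  by (auto simp: grid_def)

lemma grid_separated:
  assumes "a \<in> grid n" "b \<in> grid n" "a \<noteq> b"
  shows "\<bar>a - b\<bar> \<ge> 1 / n"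
proof -
  obtain i j where ij: "a = real i / n" "b = real j / n" "i < n"
    using assms by (auto simp: grid_def)
  then have "i \<noteq> j" using assms by auto
  then have "1 \<le> \<bar>real i - real j\<bar>" by linarith
  then have "1 / n \<le> \<bar>real i - real j\<bar> / n" by (intro divide_right_mono) auto
  also have "\<dots> = \<bar>a - b\<bar>" by (simp add: ij diff_divide_distrib[symmetric])
  finally show ?thesis .
qed

text \<open>Each factor has numerator at most \<open>\<tau> + 1\<close> and denominator at least
  \<open>1 / n\<close>.\<close>

lemma lagrange_weight_grid_le:
  assumes a: "a \<in> grid n" and x: "\<bar>x\<bar> \<le> \<tau>"
  shows "\<bar>lagrange_weight (grid n) a x\<bar> \<le> (real n * (\<tau> + 1)) ^ n"
proof -
  have n: "n > 0" using a by (auto simp: grid_def)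
  have \<tau>: "\<tau> \<ge> 0" using x by linarith
  have ge1: "1 \<le> n * (\<tau> + 1)"
    using mult_mono[of 1 "real n" 1 "\<tau> + 1"] n \<tau> by auto
  have "\<bar>lagrange_weight (grid n) a x\<bar> = (\<Prod>b\<in>grid n - {a}. \<bar>x - b\<bar> / \<bar>a - b\<bar>)"
    by (simp add: lagrange_weight_def abs_prod)
  also have "\<dots> \<le> (\<Prod>b\<in>grid n - {a}. n * (\<tau> + 1))"
  proof (intro prod_mono conjI)
    fix b assume b: "b \<in> grid n - {a}"
    have "\<bar>x - b\<bar> / \<bar>a - b\<bar> \<le> (\<tau> + 1) / (1 / n)"
      using grid_separated[of a n b] grid_bounds[of b n] a b x n
      by (intro frac_le) auto
    then show "\<bar>x - b\<bar> / \<bar>a - b\<bar> \<le> n * (\<tau> + 1)" by (simp add: mult.commute)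
  qed auto
  also have "\<dots> = (n * (\<tau> + 1)) ^ (n - 1)"
    using a by (simp add: card_grid finite_grid)
  \<comment> \<open>There are only \<open>n - 1\<close> factors; raising the exponent to
    \<open>n\<close> is allowed as the base is at least 1.\<close>
  also have "\<dots> \<le> (real n * (\<tau> + 1)) ^ n"
    using ge1 by (intro power_increasing) auto
  finally show ?thesis .
qed

text \<open>For a unit vector \<open>u\<close>, \<open>tilt a (u \<bullet> x)\<close> is the density of the Gaussian centred at \<open>a u\<close>
  with respect to the standard one.\<close>

definition tilt :: "real \<Rightarrow> real \<Rightarrow> real" where
  "tilt a t = exp (a * t - a\<^sup>2 / 2)"

definition nodes :: "real \<Rightarrow> nat \<Rightarrow> real set" where
  "nodes \<tau> n = {\<tau>, -\<tau>} \<union> grid n"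

text \<open>The outer nodes carry the mass planted in the tail; the grid coefficients are the
  Lagrange weights that cancel all moments of order below \<open>n\<close>.\<close>

definition coef :: "real \<Rightarrow> real \<Rightarrow> nat \<Rightarrow> real \<Rightarrow> real" where
  "coef \<beta> \<tau> n a = (if a = \<tau> \<or> a = - \<tau> then \<beta>
     else - \<beta> * (lagrange_weight (grid n) a \<tau> + lagrange_weight (grid n) a (- \<tau>)))"

definition perturbation :: "real \<Rightarrow> real \<Rightarrow> nat \<Rightarrow> real \<Rightarrow> real" where
  "perturbation \<beta> \<tau> n t = (\<Sum>a\<in>nodes \<tau> n. coef \<beta> \<tau> n a * tilt a t)"

lemma finite_nodes: "finite (nodes \<tau> n)"
  by (simp add: nodes_def finite_grid)

lemma abs_nodes_le:
  assumes "\<tau> \<ge> 1" "a \<in> nodes \<tau> n" shows "\<bar>a\<bar> \<le> \<tau>"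
  using assms grid_bounds[of a n] by (auto simp: nodes_def)

text \<open>Grid points lie in [0, 1), so neither outer node is among them and the sum splits
  without overlap.\<close>

lemma sum_nodes:
  assumes "\<tau> \<ge> 1"
  shows "(\<Sum>a\<in>nodes \<tau> n. coef \<beta> \<tau> n a * f a) = \<beta> * (f \<tau> + f (- \<tau>)) -
    \<beta> * (\<Sum>a\<in>grid n. (lagrange_weight (grid n) a \<tau> + lagrange_weight (grid n) a (- \<tau>)) * f a)"
proof -
  have notin: "\<tau> \<notin> grid n" "- \<tau> \<notin> grid n"
    using assms grid_bounds[of \<tau> n] grid_bounds[of "- \<tau>" n] by auto
  have "(\<Sum>a\<in>nodes \<tau> n. coef \<beta> \<tau> n a * f a) =
      (\<Sum>a\<in>{\<tau>, -\<tau>}. coef \<beta> \<tau> n a * f a) + (\<Sum>a\<in>grid n. coef \<beta> \<tau> n a * f a)"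
    unfolding nodes_def using notin by (intro sum.union_disjoint finite_grid) auto
  also have "(\<Sum>a\<in>{\<tau>, -\<tau>}. coef \<beta> \<tau> n a * f a) = \<beta> * (f \<tau> + f (- \<tau>))"
    using assms by (simp add: coef_def algebra_simps)
  also have "(\<Sum>a\<in>grid n. coef \<beta> \<tau> n a * f a) =
      (\<Sum>a\<in>grid n. - (\<beta> * ((lagrange_weight (grid n) a \<tau> + lagrange_weight (grid n) a (- \<tau>)) * f a)))"
    using notin by (intro sum.cong) (auto simp: coef_def)
  finally show ?thesis by (simp add: sum_negf sum_distrib_left)
qed

lemma coef_moments:
  assumes "\<tau> \<ge> 1" "j < n"
  shows "(\<Sum>a\<in>nodes \<tau> n. coef \<beta> \<tau> n a * a ^ j) = 0"
  unfolding sum_nodes[OF assms(1)] distrib_right sum.distrib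
  using assms finite_grid by (simp add: lagrange_weight_moment card_grid)

lemma sum_lagrange_weights_le:
  "(\<Sum>a\<in>grid n. \<bar>lagrange_weight (grid n) a \<tau> + lagrange_weight (grid n) a (- \<tau>)\<bar>) \<le>
    2 * real n * (real n * (\<tau> + 1)) ^ n" if "\<tau> \<ge> 0"
proof -
  have "(\<Sum>a\<in>grid n. \<bar>lagrange_weight (grid n) a \<tau> + lagrange_weight (grid n) a (- \<tau>)\<bar>) \<le>
      (\<Sum>a\<in>grid n. (real n * (\<tau> + 1)) ^ n + (real n * (\<tau> + 1)) ^ n)"
    using that by (intro sum_mono order_trans[OF abs_triangle_ineq] add_mono lagrange_weight_grid_le) auto
  then show ?thesis by (simp add: card_grid)
qed

text \<open>The square of this total variation is the prefactor in
  \<open>exp_correlation_le\<close>; the parameters will keep it at most 1.\<close>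

lemma sum_abs_coef_le:
  assumes "\<tau> \<ge> 1" "\<beta> \<ge> 0"
  shows "(\<Sum>a\<in>nodes \<tau> n. \<bar>coef \<beta> \<tau> n a\<bar>) \<le> \<beta> * (2 + 2 * real n * (real n * (\<tau> + 1)) ^ n)"
proof -
  have notin: "\<tau> \<notin> grid n" "- \<tau> \<notin> grid n"
    using assms grid_bounds[of \<tau> n] grid_bounds[of "- \<tau>" n] by auto
  have "(\<Sum>a\<in>nodes \<tau> n. \<bar>coef \<beta> \<tau> n a\<bar>) =
      (\<Sum>a\<in>{\<tau>, -\<tau>}. \<bar>coef \<beta> \<tau> n a\<bar>) + (\<Sum>a\<in>grid n. \<bar>coef \<beta> \<tau> n a\<bar>)"
    unfolding nodes_def using notin by (intro sum.union_disjoint finite_grid) auto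
  also have "(\<Sum>a\<in>{\<tau>, -\<tau>}. \<bar>coef \<beta> \<tau> n a\<bar>) = 2 * \<beta>"
    using assms by (simp add: coef_def)
  also have "(\<Sum>a\<in>grid n. \<bar>coef \<beta> \<tau> n a\<bar>) =
      \<beta> * (\<Sum>a\<in>grid n. \<bar>lagrange_weight (grid n) a \<tau> + lagrange_weight (grid n) a (- \<tau>)\<bar>)"
    unfolding sum_distrib_left using notin assms
    by (intro sum.cong) (auto simp: coef_def abs_mult)
  also have "\<dots> \<le> \<beta> * (2 * real n * (real n * (\<tau> + 1)) ^ n)"
    using assms by (intro mult_left_mono sum_lagrange_weights_le) auto
  finally show ?thesis by (simp add: algebra_simps)
qed

text \<open>The negative part of the perturbation grows only like \<open>exp \<bar>t\<bar>\<close>: for small \<open>t\<close> it is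
  absorbed by the constant \<open>1\<close>, for large \<open>t\<close> by the two outer tilts.\<close>

lemma one_plus_perturbation_ge:
  fixes n :: nat and \<tau> :: real
  defines "W \<equiv> 2 * real n * (real n * (\<tau> + 1)) ^ n"
  assumes \<tau>: "\<tau> \<ge> 3" and \<beta>: "\<beta> \<ge> 0"
    and W: "\<beta> * W * exp (2 * \<tau>) \<le> 1" "2 * W \<le> exp (2 * \<tau>)"
  shows "1 + perturbation \<beta> \<tau> n t \<ge> \<beta> / 2 * tilt \<tau> t"
proof -
  let ?w = "\<lambda>a. lagrange_weight (grid n) a \<tau> + lagrange_weight (grid n) a (- \<tau>)"
  have tilt_grid: "tilt a t \<le> exp \<bar>t\<bar>" if "a \<in> grid n" for a
  proof -
    have "a * t \<le> \<bar>a\<bar> * \<bar>t\<bar>" by (metis abs_ge_self abs_mult)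
    also have "\<dots> \<le> 1 * \<bar>t\<bar>" using grid_bounds[OF that] by (intro mult_right_mono) auto
    finally have "a * t - a\<^sup>2 / 2 \<le> \<bar>t\<bar>" by (smt (verit) zero_le_power2 divide_nonneg_nonneg)
    then show ?thesis by (simp add: tilt_def)
  qed
  have W0: "W \<ge> 0" using \<tau> by (simp add: W_def)
  have "(\<Sum>a\<in>grid n. ?w a * tilt a t) \<le> (\<Sum>a\<in>grid n. \<bar>?w a\<bar> * exp \<bar>t\<bar>)"
    using tilt_grid by (intro sum_mono mult_mono) (auto simp: tilt_def)
  also have "\<dots> \<le> W * exp \<bar>t\<bar>"
    unfolding sum_distrib_right[symmetric] W_def using \<tau>
    by (intro mult_right_mono sum_lagrange_weights_le) auto
  finally have "\<beta> * (\<Sum>a\<in>grid n. ?w a * tilt a t) \<le> \<beta> * (W * exp \<bar>t\<bar>)"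
    using \<beta> by (intro mult_left_mono)
  then have 1: "1 + perturbation \<beta> \<tau> n t \<ge>
      1 + \<beta> * (tilt \<tau> t + tilt (- \<tau>) t) - \<beta> * (W * exp \<bar>t\<bar>)"
    using \<tau> by (simp add: perturbation_def sum_nodes)
  have pos: "\<beta> * tilt \<tau> t \<ge> 0" "\<beta> * tilt (- \<tau>) t \<ge> 0" using \<beta> by (simp_all add: tilt_def)
  show ?thesis
  proof (cases "\<bar>t\<bar> \<le> 2 * \<tau>")
    case True
    then have "\<beta> * (W * exp \<bar>t\<bar>) \<le> \<beta> * (W * exp (2 * \<tau>))"
      using \<beta> W0 by (intro mult_left_mono) auto
    also have "\<dots> \<le> 1" using W by (simp add: mult_ac)
    finally show ?thesis using 1 pos by (simp add: algebra_simps)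
  next
    case False
    \<comment> \<open>The product \<open>\<tau> * \<bar>t\<bar>\<close> is split as 3/4 and 1/4: the
      first share dominates \<open>2 * \<bar>t\<bar>\<close> since \<open>\<tau> \<ge> 3\<close>,
      the second pays for the normalisation \<open>\<tau>\<^sup>2 / 2\<close> since
      \<open>\<bar>t\<bar> > 2 * \<tau>\<close>.\<close>
    have "2 * \<bar>t\<bar> \<le> \<tau> * \<bar>t\<bar> * (3 / 4)"
      using \<tau> mult_right_mono[of 3 \<tau> "\<bar>t\<bar>"] by simp
    moreover have "\<tau>\<^sup>2 / 2 \<le> \<tau> * \<bar>t\<bar> / 4"
      using \<tau> False mult_left_mono[of "2 * \<tau>" "\<bar>t\<bar>" \<tau>] by (simp add: power2_eq_square)
    ultimately have "2 * \<bar>t\<bar> \<le> \<tau> * \<bar>t\<bar> - \<tau>\<^sup>2 / 2" by linarith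
    then have "exp (2 * \<bar>t\<bar>) \<le> exp (\<tau> * \<bar>t\<bar> - \<tau>\<^sup>2 / 2)" by simp
    also have "\<dots> \<le> tilt \<tau> t + tilt (- \<tau>) t"
      by (cases "t \<ge> 0") (auto simp: tilt_def)
    finally have "exp (2 * \<bar>t\<bar>) \<le> tilt \<tau> t + tilt (- \<tau>) t" .
    moreover have "2 * (W * exp \<bar>t\<bar>) \<le> exp (2 * \<bar>t\<bar>)"
    proof -
      have "2 * W \<le> exp \<bar>t\<bar>" using W(2) False by (smt (verit) exp_le_cancel_iff)
      then have "(2 * W) * exp \<bar>t\<bar> \<le> exp \<bar>t\<bar> * exp \<bar>t\<bar>" by (intro mult_right_mono) auto
      then show ?thesis by (simp add: exp_add[symmetric])
    qed
    \<comment> \<open>The negative part uses up at most half of the outer tilts; the other half is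
      the asserted lower bound.\<close>
    ultimately have "\<beta> * (W * exp \<bar>t\<bar>) \<le> \<beta> * ((tilt \<tau> t + tilt (- \<tau>) t) / 2)"
      using \<beta> by (intro mult_left_mono) auto
    then show ?thesis using 1 pos by (simp add: algebra_simps add_divide_distrib)
  qed
qed

subsection \<open>Planting a direction in the Gaussian\<close>

text \<open>Completing the square turns the integrand into a constant times the normal density with
  mean \<open>u\<close>.\<close>

lemma has_bochner_integral_exp_std_normal:
  "has_bochner_integral (density lborel (\<lambda>t. ennreal (std_normal_density t)))
     (\<lambda>t. exp (u * t)) (exp (u\<^sup>2 / 2))"
proof -
  have *: "std_normal_density t * exp (u * t) = exp (u\<^sup>2 / 2) * normal_density u 1 t" for t
    by (simp add: normal_density_def power2_diff exp_add[symmetric] exp_diff[symmetric]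
        diff_divide_distrib add_divide_distrib)
  have "has_bochner_integral lborel (\<lambda>t. exp (u\<^sup>2 / 2) * normal_density u 1 t)
      (exp (u\<^sup>2 / 2) * 1)"
    by (intro has_bochner_integral_mult_right) (simp add: has_bochner_integral_iff)
  then show ?thesis
    by (intro has_bochner_integral_density) (simp_all add: *)
qed

lemma prob_space_gaussian: "prob_space (gaussian d)"
  unfolding gaussian_def by (intro prob_space_PiM prob_space_normal_density) simp

lemma sets_gaussian [measurable_cong]:
  "sets (gaussian d) = sets (\<Pi>\<^sub>M i\<in>{..<d}. (borel :: real measure))"
  unfolding gaussian_def by (intro sets_PiM_cong) auto

lemma gaussian_mgf:
  "has_bochner_integral (gaussian d) (\<lambda>x. exp (\<Sum>i<d. u i * x i)) (exp ((\<Sum>i<d. (u i)\<^sup>2) / 2))"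
proof -
  let ?N = "density lborel (\<lambda>t. ennreal (std_normal_density t))"
  have 1: "prob_space ?N" by (rule prob_space_normal_density) simp
  interpret product_sigma_finite "\<lambda>_. ?N"
    by (intro product_sigma_finite.intro prob_space_imp_sigma_finite 1)
  have I: "integrable ?N (\<lambda>t. exp (u i * t))" "integral\<^sup>L ?N (\<lambda>t. exp (u i * t)) = exp ((u i)\<^sup>2 / 2)" for i
    using has_bochner_integral_exp_std_normal[of "u i"] by (auto simp: has_bochner_integral_iff)
  show ?thesis unfolding has_bochner_integral_iff gaussian_def
    using product_integrable_prod[of "{..<d}" "\<lambda>i t. exp (u i * t)"] 
      product_integral_prod[of "{..<d}" "\<lambda>i t. exp (u i * t)"] I
    by (simp add: exp_sum sum_divide_distrib)
qed

definition dot :: "nat \<Rightarrow> (nat \<Rightarrow> real) \<Rightarrow> (nat \<Rightarrow> real) \<Rightarrow> real" where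
  "dot d u x = (\<Sum>i<d. u i * x i)"

lemma measurable_dot [measurable]: "dot d u \<in> borel_measurable (gaussian d)"
  unfolding dot_def[abs_def] by measurable

lemma measurable_tilt [measurable]: "tilt a \<in> borel_measurable borel"
  unfolding tilt_def[abs_def] by measurable

lemma measurable_perturbation [measurable]: "perturbation \<beta> \<tau> n \<in> borel_measurable borel"
  unfolding perturbation_def[abs_def] by measurable

text \<open>The moment generating function at a combination of two directions, from which the
  explicit Gaussian integrals below are derived.\<close>

lemma gaussian_exp_dot:
  "has_bochner_integral (gaussian d) (\<lambda>x. exp (a * dot d u x + b * dot d w x))
     (exp ((a\<^sup>2 * dot d u u + 2 * a * b * dot d u w + b\<^sup>2 * dot d w w) / 2))"
proof -
  have "(\<Sum>i<d. (a * u i + b * w i)\<^sup>2) =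
      a\<^sup>2 * dot d u u + 2 * a * b * dot d u w + b\<^sup>2 * dot d w w"
    by (simp add: dot_def sum_distrib_left sum.distrib[symmetric] power2_eq_square algebra_simps)
  moreover have "a * dot d u x + b * dot d w x = (\<Sum>i<d. (a * u i + b * w i) * x i)" for x
    by (simp add: dot_def sum_distrib_left sum.distrib[symmetric] algebra_simps)
  ultimately show ?thesis
    using gaussian_mgf[of d "\<lambda>i. a * u i + b * w i"] by simp
qed

text \<open>Under the tilt, \<open>dot d u x\<close> is normal with mean \<open>a\<close> and
  variance 1, and this is its moment generating function at \<open>s\<close>. The offset
  \<open>r\<close> is carried along for Chernoff bounds.\<close>

lemma gaussian_tilt_exp:
  assumes u: "dot d u u = 1"
  shows "has_bochner_integral (gaussian d) (\<lambda>x. tilt a (dot d u x) * exp (s * dot d u x + r))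
     (exp (a * s + s\<^sup>2 / 2 + r))"
proof -
  have "has_bochner_integral (gaussian d)
      (\<lambda>x. exp (r - a\<^sup>2 / 2) * exp ((a + s) * dot d u x + 0 * dot d u x))
      (exp (r - a\<^sup>2 / 2) * exp (((a + s)\<^sup>2 * dot d u u + 2 * (a + s) * 0 * dot d u u + 0\<^sup>2 * dot d u u) / 2))"
    by (intro has_bochner_integral_mult_right gaussian_exp_dot)
  then show ?thesis
    by (simp add: u tilt_def exp_add[symmetric] power2_sum add_divide_distrib algebra_simps)
qed

text \<open>The normalisations of the tilts cancel the square terms, so only the cross term
  survives.\<close>

lemma gaussian_tilt_tilt:
  assumes "dot d u u = 1" "dot d w w = 1"
  shows "has_bochner_integral (gaussian d) (\<lambda>x. tilt a (dot d u x) * tilt b (dot d w x))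
     (exp (a * b * dot d u w))"
proof -
  have "has_bochner_integral (gaussian d)
      (\<lambda>x. exp (- (a\<^sup>2 + b\<^sup>2) / 2) * exp (a * dot d u x + b * dot d w x))
      (exp (- (a\<^sup>2 + b\<^sup>2) / 2) * exp ((a\<^sup>2 * dot d u u + 2 * a * b * dot d u w + b\<^sup>2 * dot d w w) / 2))"
    by (intro has_bochner_integral_mult_right gaussian_exp_dot)
  then show ?thesis
    by (simp add: assms tilt_def exp_add[symmetric] add_divide_distrib diff_divide_distrib algebra_simps)
qed

lemma gaussian_tilt:
  assumes "dot d u u = 1"
  shows "has_bochner_integral (gaussian d) (\<lambda>x. tilt a (dot d u x)) 1"
  using gaussian_tilt_exp[OF assms, of a 0 0] by simp

lemma gaussian_perturbation_correlation:
  assumes "dot d u u = 1" "dot d w w = 1"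
  shows "has_bochner_integral (gaussian d)
     (\<lambda>x. perturbation \<beta> \<tau> n (dot d u x) * perturbation \<beta> \<tau> n (dot d w x))
     (\<Sum>a\<in>nodes \<tau> n. \<Sum>b\<in>nodes \<tau> n. coef \<beta> \<tau> n a * coef \<beta> \<tau> n b * exp (a * b * dot d u w))"
proof -
  have "perturbation \<beta> \<tau> n (dot d u x) * perturbation \<beta> \<tau> n (dot d w x) =
      (\<Sum>a\<in>nodes \<tau> n. \<Sum>b\<in>nodes \<tau> n. coef \<beta> \<tau> n a * coef \<beta> \<tau> n b *
         (tilt a (dot d u x) * tilt b (dot d w x)))" for x
    by (simp add: perturbation_def sum_product mult_ac)
  then show ?thesis
    by (simp only:) (intro has_bochner_integral_sum has_bochner_integral_mult_right gaussian_tilt_tilt assms)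
qed

text \<open>Each tilt integrates to 1, leaving the zeroth moment of the coefficients, which vanishes
  as \<open>n > 0\<close>.\<close>

lemma gaussian_perturbation:
  assumes "dot d u u = 1" and \<tau>: "\<tau> \<ge> 1" and n: "n > 0"
  shows "has_bochner_integral (gaussian d) (\<lambda>x. perturbation \<beta> \<tau> n (dot d u x)) 0"
proof -
  have "has_bochner_integral (gaussian d) (\<lambda>x. perturbation \<beta> \<tau> n (dot d u x))
      (\<Sum>a\<in>nodes \<tau> n. coef \<beta> \<tau> n a * 1)"
    unfolding perturbation_def
    by (intro has_bochner_integral_sum has_bochner_integral_mult_right gaussian_tilt assms)
  then show ?thesis using coef_moments[OF \<tau> n, of \<beta>] by simp
qed

text \<open>Chernoff bound with the optimal exponent \<open>a\<close>. Since \<open>tilt 0\<close>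
  is constantly 1, \<open>gaussian_tilt_exp\<close> covers the untilted case.\<close>

lemma gaussian_tail:
  assumes u: "dot d u u = 1" and a: "a \<ge> 0"
  shows "measure (gaussian d) {x\<in>space (gaussian d). dot d u x \<ge> a} \<le> exp (- a\<^sup>2 / 2)"
proof -
  let ?G = "gaussian d"
  interpret prob_space ?G by (rule prob_space_gaussian)
  let ?A = "{x\<in>space ?G. dot d u x \<ge> a}"
  have A: "?A \<in> sets ?G" by measurable
  have hb: "has_bochner_integral ?G (\<lambda>x. tilt 0 (dot d u x) * exp (a * dot d u x + (- a\<^sup>2)))
     (exp (0 * a + a\<^sup>2 / 2 + (- a\<^sup>2)))"
    by (rule gaussian_tilt_exp[OF u])
  have "measure ?G ?A = (\<integral>x. indicator ?A x \<partial>?G)" using A by simp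
  also have "\<dots> \<le> (\<integral>x. tilt 0 (dot d u x) * exp (a * dot d u x + (- a\<^sup>2)) \<partial>?G)"
  proof (intro integral_mono)
    show "integrable ?G (indicat_real ?A)" using A by (simp add: less_top[symmetric])
    show "integrable ?G (\<lambda>x. tilt 0 (dot d u x) * exp (a * dot d u x + (- a\<^sup>2)))"
      using hb by (simp add: has_bochner_integral_iff)
    fix x
    show "indicat_real ?A x \<le> tilt 0 (dot d u x) * exp (a * dot d u x + (- a\<^sup>2))"
      using mult_left_mono[of a "dot d u x" a] a
      by (auto simp: indicator_def tilt_def power2_eq_square)
  qed
  also have "\<dots> = exp (0 * a + a\<^sup>2 / 2 + (- a\<^sup>2))"
    using hb by (simp add: has_bochner_integral_iff)
  finally show ?thesis by (simp add: field_simps)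
qed

text \<open>Under the tilt the projection is normal around \<open>\<tau>\<close> with variance 1.
  Chernoff bounds with exponent 1 give each tail at most \<open>exp (- (7 / 2))\<close>, where 7/2 =
  4 - 1/2, hence at most 1/4.\<close>

lemma tilted_gaussian_band:
  fixes \<tau> :: real
  assumes u: "dot d u u = 1"
  defines "A \<equiv> {x\<in>space (gaussian d). \<tau> - 4 \<le> dot d u x \<and> dot d u x < \<tau> + 4}"
  shows "(\<integral>x. indicator A x * tilt \<tau> (dot d u x) \<partial>gaussian d) \<ge> 1 / 2"
    and "integrable (gaussian d) (\<lambda>x. indicator A x * tilt \<tau> (dot d u x))"
proof -
  let ?G = "gaussian d" and ?t = "\<lambda>x. tilt \<tau> (dot d u x)"
  let ?up = "\<lambda>x. ?t x * exp (1 * dot d u x + (- \<tau> - 4))"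
    and ?lo = "\<lambda>x. ?t x * exp ((- 1) * dot d u x + (\<tau> - 4))"
  have A[measurable]: "A \<in> sets ?G" unfolding A_def by measurable
  have up: "has_bochner_integral ?G ?up (exp (\<tau> * 1 + 1\<^sup>2 / 2 + (- \<tau> - 4)))"
    by (rule gaussian_tilt_exp[OF u])
  have lo: "has_bochner_integral ?G ?lo (exp (\<tau> * (-1) + (-1)\<^sup>2 / 2 + (\<tau> - 4)))"
    by (rule gaussian_tilt_exp[OF u])
  have t: "has_bochner_integral ?G ?t 1" by (rule gaussian_tilt[OF u])
  show int: "integrable ?G (\<lambda>x. indicator A x * ?t x)"
    using integrable_mult_indicator[OF A, of ?t] t by (simp add: has_bochner_integral_iff)
  have "4 \<le> exp (7 / 2 :: real)" using exp_ge_add_one_self[of "7 / 2 :: real"] by simp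
  then have e: "exp (- (7 / 2)) \<le> (1 / 4 :: real)"
    using le_imp_inverse_le[of 4 "exp (7 / 2 :: real)"] by (simp add: exp_minus)
  have hb: "has_bochner_integral ?G (\<lambda>x. ?t x - ?up x - ?lo x)
      (1 - exp (\<tau> * 1 + 1\<^sup>2 / 2 + (- \<tau> - 4)) - exp (\<tau> * (-1) + (-1)\<^sup>2 / 2 + (\<tau> - 4)))"
    by (intro has_bochner_integral_diff t up lo)
  then have "1 / 2 \<le> (\<integral>x. ?t x - ?up x - ?lo x \<partial>?G)"
    using e by (simp add: has_bochner_integral_iff)
  also have "\<dots> \<le> (\<integral>x. indicator A x * ?t x \<partial>?G)"
  proof (rule integral_mono[OF _ int])
    show "integrable ?G (\<lambda>x. ?t x - ?up x - ?lo x)"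
      using hb by (simp add: has_bochner_integral_iff)
    fix x assume x: "x \<in> space ?G"
    have pos: "?t x > 0" by (simp add: tilt_def)
    consider "x \<in> A" | "dot d u x < \<tau> - 4" | "dot d u x \<ge> \<tau> + 4" using x
      unfolding A_def by (metis (mono_tags, lifting) mem_Collect_eq linorder_not_le)
    then show "?t x - ?up x - ?lo x \<le> indicator A x * ?t x"
    proof cases
      case 1
      have "?up x > 0" "?lo x > 0" using pos by simp_all
      then show ?thesis using 1 by simp
    next
      case 2
      have "?t x * 1 \<le> ?lo x" using 2 pos by (intro mult_left_mono) auto
      moreover have "?up x > 0" "indicator A x * ?t x \<ge> 0" using pos by simp_all
      ultimately show ?thesis by linarith
    next
      case 3
      have "?t x * 1 \<le> ?up x" using 3 pos by (intro mult_left_mono) auto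
      moreover have "?lo x > 0" "indicator A x * ?t x \<ge> 0" using pos by simp_all
      ultimately show ?thesis by linarith
    qed
  qed
  finally show "(\<integral>x. indicator A x * ?t x \<partial>?G) \<ge> 1 / 2" .
qed

text \<open>\<open>ennreal\<close> sends negative values to 0, so the formulas below are proved
  under the bound \<open>ge\<close>, which makes the density nonnegative.\<close>

definition planted :: "nat \<Rightarrow> real \<Rightarrow> real \<Rightarrow> nat \<Rightarrow> (nat \<Rightarrow> real) \<Rightarrow> (nat \<Rightarrow> real) measure" where
  "planted d \<beta> \<tau> n u =
     density (gaussian d) (\<lambda>x. ennreal (1 + perturbation \<beta> \<tau> n (dot d u x)))"

lemma sets_planted [simp, measurable_cong]: "sets (planted d \<beta> \<tau> n u) = sets (gaussian d)"
  by (simp add: planted_def)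

context
  fixes d n :: nat and \<beta> \<tau> :: real and u :: "nat \<Rightarrow> real"
  assumes u: "dot d u u = 1" and \<tau>: "\<tau> \<ge> 1" and n: "n > 0" and \<beta>: "\<beta> \<ge> 0"
    and ge: "\<And>t. 1 + perturbation \<beta> \<tau> n t \<ge> \<beta> / 2 * tilt \<tau> t"
begin

lemma one_plus_perturbation_nonneg: "1 + perturbation \<beta> \<tau> n t \<ge> 0"
  using ge[of t] \<beta> by (intro order_trans[OF _ ge]) (simp add: tilt_def)

lemma integral_planted:
  assumes "q \<in> borel_measurable (gaussian d)"
  shows "(\<integral>x. q x \<partial>planted d \<beta> \<tau> n u) =
    (\<integral>x. (1 + perturbation \<beta> \<tau> n (dot d u x)) * q x \<partial>gaussian d)"
  unfolding planted_def using assms one_plus_perturbation_nonneg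
  by (subst integral_density) auto

lemma prob_space_planted: "prob_space (planted d \<beta> \<tau> n u)"
proof
  interpret prob_space "gaussian d" by (rule prob_space_gaussian)
  have hb: "has_bochner_integral (gaussian d) (\<lambda>x. 1 + perturbation \<beta> \<tau> n (dot d u x)) (1 + 0)"
    using has_bochner_integral_add[OF _ gaussian_perturbation[OF u \<tau> n, of \<beta>], of "\<lambda>_. 1" 1]
    by (simp add: has_bochner_integral_iff prob_space)
  have "emeasure (planted d \<beta> \<tau> n u) (space (planted d \<beta> \<tau> n u)) =
      (\<integral>\<^sup>+x. ennreal (1 + perturbation \<beta> \<tau> n (dot d u x)) \<partial>gaussian d)"
    by (simp add: planted_def emeasure_density cong: nn_integral_cong)
  also have "\<dots> = ennreal 1"
    using hb one_plus_perturbation_nonneg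
    by (subst nn_integral_eq_integral) (auto simp: has_bochner_integral_iff)
  finally show "emeasure (planted d \<beta> \<tau> n u) (space (planted d \<beta> \<tau> n u)) = 1" by simp
qed

lemma planted_query_difference:
  assumes q: "sq_query (gaussian d) q"
  shows "(\<integral>x. q x \<partial>planted d \<beta> \<tau> n u) - (\<integral>x. q x \<partial>gaussian d) =
    (\<integral>x. q x * perturbation \<beta> \<tau> n (dot d u x) \<partial>gaussian d)"
proof -
  interpret prob_space "gaussian d" by (rule prob_space_gaussian)
  have q': "q \<in> borel_measurable (gaussian d)" "\<And>x. x \<in> space (gaussian d) \<Longrightarrow> \<bar>q x\<bar> \<le> 1"
    using q by (auto simp: sq_query_def)
  note [measurable] = q'(1)
  have 1: "integrable (gaussian d) q"
    using q' by (intro integrable_const_bound[of _ 1]) auto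
  have 2: "integrable (gaussian d) (\<lambda>x. q x * perturbation \<beta> \<tau> n (dot d u x))"
  proof (rule Bochner_Integration.integrable_bound)
    show "integrable (gaussian d) (\<lambda>x. perturbation \<beta> \<tau> n (dot d u x))"
      using gaussian_perturbation[OF u \<tau> n, of \<beta>] by (simp add: has_bochner_integral_iff)
    show "AE x in gaussian d. norm (q x * perturbation \<beta> \<tau> n (dot d u x)) \<le>
        norm (perturbation \<beta> \<tau> n (dot d u x))"
      using q'(2) by (intro AE_I2) (simp add: abs_mult mult_left_le_one_le)
  qed measurable
  show ?thesis
    unfolding integral_planted[OF q'(1)] using 1 2
    by (simp add: distrib_right mult.commute[of "perturbation _ _ _ _"])
qed

text \<open>By \<open>ge\<close> the density keeps half of the weight \<open>\<beta>\<close> of the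
  tilt at \<open>\<tau>\<close>, under which the band has mass at least 1/2.\<close>

lemma planted_band:
  "measure (planted d \<beta> \<tau> n u)
     {x\<in>space (gaussian d). \<tau> - 4 \<le> dot d u x \<and> dot d u x < \<tau> + 4} \<ge> \<beta> / 4"
proof -
  let ?A = "{x\<in>space (gaussian d). \<tau> - 4 \<le> dot d u x \<and> dot d u x < \<tau> + 4}"
  let ?p = "\<lambda>x. 1 + perturbation \<beta> \<tau> n (dot d u x)"
  interpret prob_space "gaussian d" by (rule prob_space_gaussian)
  interpret P: prob_space "planted d \<beta> \<tau> n u" by (rule prob_space_planted)
  have A[measurable]: "?A \<in> sets (gaussian d)" by measurable
  have "integrable (gaussian d) ?p"
    using gaussian_perturbation[OF u \<tau> n, of \<beta>] by (simp add: has_bochner_integral_iff)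
  then have int: "integrable (gaussian d) (\<lambda>x. ?p x * indicat_real ?A x)"
    using integrable_mult_indicator[OF A, of ?p] by (simp add: mult.commute)
  have "\<beta> / 4 \<le> \<beta> / 2 * (\<integral>x. indicator ?A x * tilt \<tau> (dot d u x) \<partial>gaussian d)"
    using mult_left_mono[OF tilted_gaussian_band(1)[OF u, of \<tau>], of "\<beta> / 2"] \<beta> by simp
  also have "\<dots> = (\<integral>x. \<beta> / 2 * (indicator ?A x * tilt \<tau> (dot d u x)) \<partial>gaussian d)"
    by simp
  also have "\<dots> \<le> (\<integral>x. ?p x * indicat_real ?A x \<partial>gaussian d)"
  proof (intro integral_mono int integrable_mult_right tilted_gaussian_band(2)[OF u])
    fix x
    show "\<beta> / 2 * (indicator ?A x * tilt \<tau> (dot d u x)) \<le> ?p x * indicat_real ?A x"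
      using ge[of "dot d u x"] by (simp add: indicator_def)
  qed
  also have "\<dots> = (\<integral>x. indicat_real ?A x \<partial>planted d \<beta> \<tau> n u)"
    by (rule integral_planted[symmetric]) measurable
  also have "\<dots> = measure (planted d \<beta> \<tau> n u) ?A"
    using A by simp
  finally show ?thesis .
qed

end

subsection \<open>The lower bound\<close>

definition direction :: "nat \<Rightarrow> (nat \<Rightarrow> real) \<Rightarrow> nat \<Rightarrow> real" where
  "direction d s i = s i / sqrt (real d)"

lemma dot_direction: "dot d (direction d s) (direction d w) = (\<Sum>i<d. s i * w i) / d"
  by (simp add: dot_def direction_def sum_divide_distrib)

lemma sign_vector_cases: "s \<in> sign_vectors d \<Longrightarrow> i < d \<Longrightarrow> s i = -1 \<or> s i = 1"
  by (auto simp: sign_vectors_def PiE_iff)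

lemma dot_direction_self:
  assumes "s \<in> sign_vectors d" "d > 0"
  shows "dot d (direction d s) (direction d s) = 1"
proof -
  have "(\<Sum>i<d. s i * s i) = (\<Sum>i<d. 1)"
    using sign_vector_cases[OF assms(1)] by (intro sum.cong) fastforce+
  then show ?thesis using assms(2) by (simp add: dot_direction)
qed

lemma abs_dot_direction_le:
  assumes "s \<in> sign_vectors d" "w \<in> sign_vectors d"
  shows "\<bar>dot d (direction d s) (direction d w)\<bar> \<le> 1"
proof -
  have "\<bar>\<Sum>i<d. s i * w i\<bar> \<le> (\<Sum>i<d. 1)"
    using sign_vector_cases[OF assms(1)] sign_vector_cases[OF assms(2)]
    by (intro order_trans[OF sum_abs] sum_mono) (fastforce simp: abs_mult)
  then show ?thesis by (cases "d = 0") (simp_all add: dot_direction)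
qed

lemma halfspace_mem:
  assumes "dot d u u = 1"
  shows "(\<lambda>x. pm_sign (dot d u x + t)) \<in> general_halfspaces d"
proof -
  have "\<exists>i<d. u i \<noteq> 0"
  proof (rule ccontr)
    assume "\<not> ?thesis"
    then have "dot d u u = 0" by (simp add: dot_def)
    then show False using assms by simp
  qed
  then show ?thesis unfolding general_halfspaces_def dot_def by blast
qed

lemma measurable_pm_sign [measurable]: "pm_sign \<in> borel_measurable borel"
  unfolding pm_sign_def[abs_def] by measurable

text \<open>The counting lemma for the directions given by sign vectors, divided by
  \<open>2 ^ d\<close>. The first two conditions on \<open>W\<close> give nonnegative densities, the
  third bounds the total variation of the coefficients by 1, \<open>\<gamma>\<close> makes nearly
  orthogonal directions almost uncorrelated, and \<open>8 * \<epsilon> < \<beta>\<close> lifts the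
  band mass \<open>\<beta> / 4\<close> above \<open>2 * \<epsilon>\<close>.\<close>

lemma tds_sq_learner_halfspaces_bound:
  fixes d m n Q :: nat and \<beta> \<tau> \<eta> \<phi> \<epsilon> \<delta> :: real
  defines "W \<equiv> 2 * real n * (real n * (\<tau> + 1)) ^ n"
  assumes learner: "tds_sq_learner (general_halfspaces d) (gaussian d) \<epsilon> \<delta> m \<phi> R A"
    and queries: "\<And>r S. at_most_queries (A r S) Q"
    and d: "d > 0" and n: "n > 0" and \<tau>: "\<tau> \<ge> 4" and \<beta>: "\<beta> \<ge> 0" "8 * \<epsilon> < \<beta>" and \<phi>: "\<phi> > 0"
    and \<eta>: "\<eta> \<ge> 0"
    and W: "\<beta> * W * exp (2 * \<tau>) \<le> 1" "2 * W \<le> exp (2 * \<tau>)" "\<beta> * (2 + W) \<le> 1"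
    and \<gamma>: "2 * ((\<eta> * \<tau>\<^sup>2) ^ n * exp (\<eta> * \<tau>\<^sup>2)) \<le> \<phi>\<^sup>2"
  shows "1 - 3 * \<delta> - m * exp (- (\<tau> - 4)\<^sup>2 / 2) \<le>
    Q * (8 * exp (- (real d * \<eta>\<^sup>2 / 2)) * exp (\<tau>\<^sup>2) / \<phi>\<^sup>2)"
proof -
  let ?G = "gaussian d" and ?V = "sign_vectors d"
  define u where "u = direction d"
  define D where "D s = planted d \<beta> \<tau> n (u s)" for s
  define c where "c s x = pm_sign (dot d (u s) x + (- (\<tau> - 4)))" for s x
  define c' where "c' s x = pm_sign (dot d (u s) x + (- (\<tau> + 4)))" for s x
  define f where "f s x = perturbation \<beta> \<tau> n (dot d (u s) x)" for s x
  define \<gamma>' where "\<gamma>' = (\<eta> * \<tau>\<^sup>2) ^ n * exp (\<eta> * \<tau>\<^sup>2)"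
  define N where "N = 2 * 2 ^ d * exp (- (real d * \<eta>\<^sup>2 / 2))"
  define \<kappa> where "\<kappa> = 4 * N * exp (\<tau>\<^sup>2) / \<phi>\<^sup>2"
  interpret prob_space ?G by (rule prob_space_gaussian)
  have \<tau>1: "\<tau> \<ge> 1" using \<tau> by simp
  have u: "dot d (u s) (u s) = 1" if "s \<in> ?V" for s
    using dot_direction_self[OF that d] by (simp add: u_def)
  have ge: "1 + perturbation \<beta> \<tau> n t \<ge> \<beta> / 2 * tilt \<tau> t" for t
    using one_plus_perturbation_ge[of \<tau> \<beta> n t] \<tau> \<beta> W by (simp add: W_def)
  have coef1: "(\<Sum>a\<in>nodes \<tau> n. \<bar>coef \<beta> \<tau> n a\<bar>)\<^sup>2 \<le> 1"
    using sum_abs_coef_le[OF \<tau>1 \<beta>(1), of n] W(3)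
    by (intro power_le_one sum_nonneg) (auto simp: W_def)
  have corr: "has_bochner_integral ?G (\<lambda>x. f s x * f w x)
     (\<Sum>a\<in>nodes \<tau> n. \<Sum>b\<in>nodes \<tau> n. coef \<beta> \<tau> n a * coef \<beta> \<tau> n b * exp (a * b * dot d (u s) (u w)))"
    if "s \<in> ?V" "w \<in> ?V" for s w
    unfolding f_def using u that by (intro gaussian_perturbation_correlation)
  \<comment> \<open>Used twice: with \<open>r = \<eta>\<close>, \<open>j = n\<close> for nearly
    orthogonal pairs, and with \<open>r = 1\<close>, \<open>j = 0\<close> for the crude bound
    \<open>exp (\<tau>\<^sup>2)\<close> on all pairs.\<close>
  have le: "(\<integral>x. f s x * f w x \<partial>?G) \<le> (r * \<tau>\<^sup>2) ^ j * exp (r * \<tau>\<^sup>2)"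
    if sw: "s \<in> ?V" "w \<in> ?V" and r: "\<bar>dot d (u s) (u w)\<bar> \<le> r" and j: "j \<le> n" for s w r j
  proof -
    have "(\<integral>x. f s x * f w x \<partial>?G) \<le> (\<Sum>a\<in>nodes \<tau> n. \<bar>coef \<beta> \<tau> n a\<bar>)\<^sup>2 *
        ((r * \<tau>\<^sup>2) ^ j * exp (r * \<tau>\<^sup>2))"
    proof -
      have "\<bar>\<Sum>a\<in>nodes \<tau> n. \<Sum>b\<in>nodes \<tau> n.
          coef \<beta> \<tau> n a * coef \<beta> \<tau> n b * exp (a * b * dot d (u s) (u w))\<bar> \<le>
          (\<Sum>a\<in>nodes \<tau> n. \<bar>coef \<beta> \<tau> n a\<bar>)\<^sup>2 * ((r * \<tau>\<^sup>2) ^ j * exp (r * \<tau>\<^sup>2))"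
        using j r by (intro exp_correlation_le finite_nodes abs_nodes_le[OF \<tau>1] coef_moments[OF \<tau>1]) auto
      then show ?thesis using corr[OF sw] by (simp add: has_bochner_integral_iff)
    qed
    also have "\<dots> \<le> 1 * ((r * \<tau>\<^sup>2) ^ j * exp (r * \<tau>\<^sup>2))"
      using coef1 r by (intro mult_right_mono) auto
    finally show ?thesis by simp
  qed
  have few: "real (card {s\<in>?V. \<not> \<bar>(\<integral>x. q x \<partial>?G) - (\<integral>x. q x \<partial>D s)\<bar> \<le> \<phi>}) \<le> \<kappa>"
    if q: "sq_query ?G q" for q
  proof -
    have diff: "(\<integral>x. q x * f s x \<partial>?G) = (\<integral>x. q x \<partial>D s) - (\<integral>x. q x \<partial>?G)" if "s \<in> ?V" for s
      using planted_query_difference[OF u[OF that] \<tau>1 n \<beta>(1) ge q] by (simp add: D_def f_def)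
    have "{s\<in>?V. \<not> \<bar>(\<integral>x. q x \<partial>?G) - (\<integral>x. q x \<partial>D s)\<bar> \<le> \<phi>} =
        {s\<in>?V. \<not> \<bar>\<integral>x. q x * f s x \<partial>?G\<bar> \<le> \<phi>}"
      by (auto simp: diff abs_minus_commute)
    also have "real (card \<dots>) \<le> \<kappa>"
      unfolding \<kappa>_def
    proof (rule card_correlated_le[where \<gamma> = \<gamma>'
          and close = "\<lambda>s w. \<bar>\<Sum>i<d. s i * w i\<bar> > real d * \<eta>"])
      show "finite ?V" by (rule finite_sign_vectors)
      show "f s \<in> borel_measurable ?G" for s unfolding f_def[abs_def] by measurable
      show "integrable ?G (\<lambda>x. f s x * f w x)" if "s \<in> ?V" "w \<in> ?V" for s w
        using corr[OF that] by (simp add: has_bochner_integral_iff)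
      show "real (card {w\<in>?V. \<bar>\<Sum>i<d. s i * w i\<bar> > real d * \<eta>}) \<le> N" if "s \<in> ?V" for s
        unfolding N_def by (rule sign_vectors_correlated_le[OF that \<eta>])
      show "(\<integral>x. f s x * f w x \<partial>?G) \<le> \<gamma>'"
        if "s \<in> ?V" "w \<in> ?V" "\<not> \<bar>\<Sum>i<d. s i * w i\<bar> > real d * \<eta>" for s w
        unfolding \<gamma>'_def using that d
        by (intro le) (auto simp: u_def dot_direction field_simps)
      show "(\<integral>x. f s x * f w x \<partial>?G) \<le> exp (\<tau>\<^sup>2)" if "s \<in> ?V" "w \<in> ?V" for s w
        using le[OF that, of 1 0] abs_dot_direction_le[OF that] by (simp add: u_def)
      show "0 \<le> N" "0 \<le> exp (\<tau>\<^sup>2)" "0 \<le> \<gamma>'" using \<eta> by (simp_all add: N_def \<gamma>'_def)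
      show "\<phi> > 0" "2 * \<gamma>' \<le> \<phi>\<^sup>2" using \<phi> \<gamma> by (simp_all add: \<gamma>'_def)
      show "q \<in> borel_measurable ?G" "\<And>x. x \<in> space ?G \<Longrightarrow> \<bar>q x\<bar> \<le> 1"
        using q by (auto simp: sq_query_def)
    qed
    finally show ?thesis .
  qed
  have "real (card ?V) * (1 - 3 * \<delta> - m * exp (- (\<tau> - 4)\<^sup>2 / 2)) \<le> Q * \<kappa>"
  proof (rule tds_sq_learner_counting[OF learner queries prob_space_gaussian])
    show "finite ?V" by (rule finite_sign_vectors)
    show "0 \<le> \<phi>" using \<phi> by simp
    fix s assume s: "s \<in> ?V"
    show "prob_space (D s)"
      unfolding D_def by (rule prob_space_planted[OF u[OF s] \<tau>1 n \<beta>(1) ge])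
    show "sets (D s) = sets ?G" by (simp add: D_def)
    show "c s \<in> general_halfspaces d" "c' s \<in> general_halfspaces d"
      unfolding c_def[abs_def] c'_def[abs_def] by (rule halfspace_mem[OF u[OF s]])+
    show "c s \<in> borel_measurable ?G" "c' s \<in> borel_measurable ?G"
      unfolding c_def[abs_def] c'_def[abs_def] by measurable
    have "{x\<in>space ?G. c s x \<noteq> c' s x} =
        {x\<in>space ?G. \<tau> - 4 \<le> dot d (u s) x \<and> dot d (u s) x < \<tau> + 4}"
      by (auto simp: c_def c'_def pm_sign_def split: if_splits)
    then show "2 * \<epsilon> < measure (D s) {x\<in>space ?G. c s x \<noteq> c' s x}"
      using planted_band[OF u[OF s] \<tau>1 n \<beta>(1) ge] \<beta>(2) by (simp add: D_def)
    have "{x\<in>space ?G. c s x \<noteq> - 1 \<or> c' s x \<noteq> - 1} = {x\<in>space ?G. \<tau> - 4 \<le> dot d (u s) x}"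
      by (auto simp: c_def c'_def pm_sign_def split: if_splits)
    then show "measure ?G {x\<in>space ?G. c s x \<noteq> - 1 \<or> c' s x \<noteq> - 1} \<le> exp (- (\<tau> - 4)\<^sup>2 / 2)"
      using gaussian_tail[OF u[OF s], of "\<tau> - 4"] \<tau> by simp
  qed (rule few)
  also have "Q * \<kappa> = real (card ?V) * (Q * (8 * exp (- (real d * \<eta>\<^sup>2 / 2)) * exp (\<tau>\<^sup>2) / \<phi>\<^sup>2))"
    by (simp add: \<kappa>_def N_def card_sign_vectors)
  finally show ?thesis
    by (rule mult_left_le_imp_le) (simp add: card_sign_vectors)
qed

section \<open>Choice of parameters and asymptotics\<close>

text \<open>All demands on the parameters are reduced to the single variable \<open>L\<close>.
  Decisive are that \<open>(L / ln L) * L\<close> is of lower order than \<open>L\<^sup>2\<close>,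
  so the sample misses the tail, and that \<open>exp (L / 10)\<close> outgrows
  \<open>exp (L / 60)\<close>, so the queries are too few.\<close>

lemma eventually_parameters_admissible:
  "\<forall>\<^sub>F L :: real in at_top.
     L \<ge> 16 \<and> ln L \<ge> 1 \<and> L / ln L \<ge> 16 \<and>
     exp (L / 5) \<le> exp (L / 4) - 1 \<and> exp (L / 4) + 1 \<le> exp (L / 3) \<and>
     9 * exp (- L) * (2 * L * exp (L / 4)) * exp (L / 2) \<le> 1 \<and>
     2 * (2 * L * exp (L / 4)) \<le> exp (L / 2) \<and>
     9 * exp (- L) * (2 + 2 * L * exp (L / 4)) \<le> 1 \<and>
     exp (- L / 20) * L\<^sup>2 \<le> exp (- L / 40) \<and>
     6 * exp (- (L / ln L) * L / 640) \<le> exp (- (L / ln L) * L / 1500) \<and>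
     exp ((L / ln L) * L / 3 - (L / 4 - 4)\<^sup>2 / 2) \<le> 1 / 20 \<and>
     8 * exp (exp (L / 60) - exp (L / 10) / 2 + L\<^sup>2 / 16 + (L / ln L) * L / 1500) \<le> 1 / 2"
  by (intro eventually_conj; real_asymp)

lemma tolerance_bound:
  fixes d m Q :: nat and \<epsilon> \<delta> \<phi> g :: real
  defines "L \<equiv> ln (1 / \<epsilon>)"
  assumes \<epsilon>: "\<epsilon> > 0" and g: "g \<le> 1 / 20"
    and d: "\<bar>real d - \<epsilon> powr (-1/4)\<bar> < 1"
    and \<delta>: "1 - \<delta> \<ge> 0.95" and \<phi>: "\<phi> > 0"
    and m: "real m \<le> real d powr (L / ln L)"
    and Q: "real Q \<le> 2 powr (real d powr g)"
    and queries: "\<forall>r S. at_most_queries (A r S) Q"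
    and learner: "tds_sq_learner (general_halfspaces d) (gaussian d) \<epsilon> \<delta> m \<phi> R A"
    and L: "L \<ge> 16" "ln L \<ge> 1" "L / ln L \<ge> 16"
      "exp (L / 5) \<le> exp (L / 4) - 1" "exp (L / 4) + 1 \<le> exp (L / 3)"
      "9 * exp (- L) * (2 * L * exp (L / 4)) * exp (L / 2) \<le> 1"
      "2 * (2 * L * exp (L / 4)) \<le> exp (L / 2)"
      "9 * exp (- L) * (2 + 2 * L * exp (L / 4)) \<le> 1"
      "exp (- L / 20) * L\<^sup>2 \<le> exp (- L / 40)"
      "6 * exp (- (L / ln L) * L / 640) \<le> exp (- (L / ln L) * L / 1500)"
      "exp ((L / ln L) * L / 3 - (L / 4 - 4)\<^sup>2 / 2) \<le> 1 / 20"
      "8 * exp (exp (L / 60) - exp (L / 10) / 2 + L\<^sup>2 / 16 + (L / ln L) * L / 1500) \<le> 1 / 2"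
  shows "\<phi> \<le> real d powr (- (1 / 1000 * (L / ln L)))"
proof (rule ccontr)
  define k where "k = L / ln L"
  \<comment> \<open>As \<open>k * ln L = L\<close>, this many nodes keep the Lagrange weights below
    \<open>L ^ (2 * n) \<le> exp (L / 4)\<close>.\<close>
  define n where "n = nat \<lfloor>k / 8\<rfloor>"
  \<comment> \<open>Large enough that the tail \<open>exp (- (\<tau> - 4)\<^sup>2 / 2)\<close> beats
    the sample size, small enough that \<open>W * exp (2 * \<tau>)\<close> stays below
    \<open>1 / (9 * \<epsilon>)\<close>.\<close>
  define \<tau> where "\<tau> = L / 4"
  \<comment> \<open>Then \<open>d * \<eta>\<^sup>2\<close> is the square root of \<open>d\<close>,
    which makes correlated directions extremely rare, while \<open>\<eta> * \<tau>\<^sup>2\<close>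
    is still a negative power of \<open>1 / \<epsilon>\<close>.\<close>
  define \<eta> where "\<eta> = real d powr (- 1 / 4)"
  define W where "W = 2 * real n * (real n * (\<tau> + 1)) ^ n"
  assume "\<not> ?thesis"
  then have large: "real d powr (- (1 / 1000 * k)) < \<phi>" by (simp add: k_def not_le)
  have k: "k \<ge> 16" "k \<le> L" "k * ln L = L"
    using L(1-3) by (auto simp: k_def field_simps)
  have n: "k / 16 \<le> n" "n \<le> k / 8"
    using k unfolding n_def by linarith+
  have lnL: "ln \<epsilon> = - L" using \<epsilon> by (simp add: L_def ln_div)
  have \<epsilon>L: "\<epsilon> = exp (- L)" using \<epsilon> lnL by (metis exp_ln)
  have "\<epsilon> powr (- 1 / 4) = exp (L / 4)" using \<epsilon> lnL by (simp add: powr_def)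
  then have d': "exp (L / 5) \<le> d" "d \<le> exp (L / 3)" using d L(4,5) by linarith+
  have d0: "real d > 0" using d'(1) exp_gt_zero[of "L / 5"] by linarith
  then have d1: "d > 0" by simp
  have lnd: "L / 5 \<le> ln d" "ln d \<le> L / 3"
    using d' d0 ln_le_cancel_iff[of "exp (L / 5)" "real d"] ln_le_cancel_iff[of "real d" "exp (L / 3)"]
    by simp_all
  have dp: "real d powr a = exp (a * ln d)" for a using d0 by (simp add: powr_def)

  have W: "W \<le> 2 * L * exp (L / 4)"
  proof -
    have "real n * (\<tau> + 1) \<le> L * L"
      using n k L(1) by (intro mult_mono) (auto simp: \<tau>_def)
    then have "(real n * (\<tau> + 1)) ^ n \<le> (L * L) ^ n"
      using L(1) by (intro power_mono) (auto simp: \<tau>_def)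
    also have "\<dots> = exp (ln L) ^ (2 * n)"
      using L(1) by (simp add: power_mult power2_eq_square)
    also have "\<dots> = exp (2 * n * ln L)" by (simp add: exp_of_nat_mult[symmetric])
    also have "\<dots> \<le> exp (L / 4)"
      using mult_right_mono[OF n(2), of "ln L"] L(2) k(3) by simp
    finally have "(real n * (\<tau> + 1)) ^ n \<le> exp (L / 4)" .
    then show ?thesis
      unfolding W_def using n k L(1) by (intro mult_mono) (auto simp: \<tau>_def)
  qed
  have W1: "9 * \<epsilon> * W * exp (2 * \<tau>) \<le> 1"
  proof -
    have "9 * \<epsilon> * W * exp (2 * \<tau>) \<le> 9 * exp (- L) * (2 * L * exp (L / 4)) * exp (L / 2)"
      unfolding \<epsilon>L using W by (simp add: \<tau>_def mult_left_mono mult_right_mono)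
    then show ?thesis using L(6) by linarith
  qed
  have W2: "2 * W \<le> exp (2 * \<tau>)" using W L(7) by (simp add: \<tau>_def)
  have W3: "9 * \<epsilon> * (2 + W) \<le> 1"
  proof -
    have "9 * \<epsilon> * (2 + W) \<le> 9 * exp (- L) * (2 + 2 * L * exp (L / 4))"
      unfolding \<epsilon>L using W by (intro mult_left_mono) auto
    then show ?thesis using L(8) by linarith
  qed

  \<comment> \<open>The exponent 1/1000 meets \<open>ln d \<le> L / 3\<close> and becomes 1/3000;
    squaring gives 1/1500.\<close>
  have "real d powr (- (1 / 1000 * k)) \<ge> exp (- k * L / 3000)"
    using mult_left_mono[OF lnd(2), of "k / 1000"] k by (simp add: dp)
  then have "\<phi> \<ge> exp (- k * L / 3000)" using large by linarith
  then have "\<phi>\<^sup>2 \<ge> exp (- k * L / 3000) ^ 2" by (intro power_mono) auto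
  then have \<phi>2: "\<phi>\<^sup>2 \<ge> exp (- k * L / 1500)" by (simp add: exp_double[symmetric] mult.commute)
  have \<gamma>: "2 * ((\<eta> * \<tau>\<^sup>2) ^ n * exp (\<eta> * \<tau>\<^sup>2)) \<le> \<phi>\<^sup>2"
  proof -
    have "\<eta> \<le> exp (- L / 20)" using lnd by (simp add: \<eta>_def dp)
    then have "\<eta> * \<tau>\<^sup>2 \<le> exp (- L / 20) * L\<^sup>2"
      using L(1) by (intro mult_mono power_mono) (auto simp: \<tau>_def)
    then have 1: "\<eta> * \<tau>\<^sup>2 \<le> exp (- L / 40)" using L(9) by linarith
    have "exp (- L / 40) \<le> 1" using L(1) by simp
    then have "\<eta> * \<tau>\<^sup>2 \<le> 1" using 1 by linarith
    then have "exp (\<eta> * \<tau>\<^sup>2) \<le> exp 1" by simp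
    then have 2: "exp (\<eta> * \<tau>\<^sup>2) \<le> 3" using exp_le by linarith
    have "(\<eta> * \<tau>\<^sup>2) ^ n \<le> exp (- L / 40) ^ n"
      using 1 by (intro power_mono) (auto simp: \<eta>_def)
    also have "\<dots> = exp (- (n * L / 40))" by (simp add: exp_of_nat_mult[symmetric])
    \<comment> \<open>Since \<open>n \<ge> k / 16\<close>, the denominator is 16 times 40.\<close>
    also have "\<dots> \<le> exp (- k * L / 640)"
      using mult_right_mono[OF n(1), of L] L(1) by simp
    finally have "(\<eta> * \<tau>\<^sup>2) ^ n * exp (\<eta> * \<tau>\<^sup>2) \<le> exp (- k * L / 640) * 3"
      using 2 by (intro mult_mono) auto
    then show ?thesis using L(10) \<phi>2 by (simp add: k_def not_le)
  qed

  have rare: "m * exp (- (\<tau> - 4)\<^sup>2 / 2) \<le> 1 / 20"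
  proof -
    have "real m \<le> exp (k * ln d)" using m by (simp add: dp k_def)
    also have "\<dots> \<le> exp (k * L / 3)" using mult_left_mono[OF lnd(2), of k] k by simp
    finally have "m * exp (- (\<tau> - 4)\<^sup>2 / 2) \<le> exp (k * L / 3) * exp (- (\<tau> - 4)\<^sup>2 / 2)"
      by (intro mult_right_mono) auto
    also have "\<dots> = exp ((L / ln L) * L / 3 - (L / 4 - 4)\<^sup>2 / 2)"
      by (simp add: exp_add[symmetric] k_def \<tau>_def)
    finally show ?thesis using L(11) by linarith
  qed

  have fooled: "Q * (8 * exp (- (real d * \<eta>\<^sup>2 / 2)) * exp (\<tau>\<^sup>2) / \<phi>\<^sup>2) \<le> 1 / 2"
  proof -
    \<comment> \<open>With \<open>ln d \<le> L / 3\<close> the exponent 1/20 yields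
      \<open>L / 60\<close>; below, \<open>d powr (1 / 2)\<close> with
      \<open>ln d \<ge> L / 5\<close> yields the larger \<open>L / 10\<close>.\<close>
    have "real d powr g \<le> real d powr (1 / 20)"
      using g d1 by (intro powr_mono) auto
    also have "\<dots> \<le> exp (L / 60)" using lnd by (simp add: dp)
    finally have "2 powr (real d powr g) \<le> (2 :: real) powr exp (L / 60)"
      by (intro powr_mono) auto
    also have "\<dots> \<le> exp (exp (L / 60))"
      using ln_2_less_1 by (simp add: powr_def)
    finally have Q': "Q \<le> exp (exp (L / 60))" using Q by linarith
    have "real d * \<eta>\<^sup>2 = real d powr 1 * (real d powr (- 1 / 4) * real d powr (- 1 / 4))"
      using d0 by (simp add: \<eta>_def power2_eq_square)
    also have "\<dots> = real d powr (1 / 2)" by (simp only: powr_add[symmetric]) simp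
    also have "\<dots> \<ge> exp (L / 10)" using lnd by (simp add: dp)
    finally have "exp (- (real d * \<eta>\<^sup>2 / 2)) \<le> exp (- exp (L / 10) / 2)" by simp
    moreover have "exp (\<tau>\<^sup>2) = exp (L\<^sup>2 / 16)" by (simp add: \<tau>_def power_divide)
    moreover have "1 / \<phi>\<^sup>2 \<le> exp (k * L / 1500)"
      using le_imp_inverse_le[OF \<phi>2] by (simp add: exp_minus inverse_eq_divide)
    ultimately have "Q * (8 * exp (- (real d * \<eta>\<^sup>2 / 2)) * exp (\<tau>\<^sup>2) * (1 / \<phi>\<^sup>2)) \<le>
        exp (exp (L / 60)) * (8 * exp (- exp (L / 10) / 2) * exp (L\<^sup>2 / 16) * exp (k * L / 1500))"
      using Q' by (intro mult_mono) auto
    also have "\<dots> = 8 * exp (exp (L / 60) - exp (L / 10) / 2 + L\<^sup>2 / 16 + (L / ln L) * L / 1500)"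
      unfolding k_def[symmetric] diff_conv_add_uminus exp_add by simp
    finally show ?thesis using L(12) by simp
  qed

  have "1 - 3 * \<delta> - m * exp (- (\<tau> - 4)\<^sup>2 / 2) \<le>
      Q * (8 * exp (- (real d * \<eta>\<^sup>2 / 2)) * exp (\<tau>\<^sup>2) / \<phi>\<^sup>2)"
  proof (rule tds_sq_learner_halfspaces_bound[OF learner _ d1, where n = n and \<beta> = "9 * \<epsilon>"])
    show "at_most_queries (A r S) Q" for r S using queries by blast
    show "n > 0" using n k by (cases n) auto
    show "\<tau> \<ge> 4" using L(1) by (simp add: \<tau>_def)
    show "0 \<le> \<eta>" by (simp add: \<eta>_def)
  qed (use \<epsilon> \<phi> W1 W2 W3 \<gamma> in \<open>simp_all add: W_def\<close>)
  \<comment> \<open>The left side is now at least 1 - 3/20 - 1/20 = 4/5, the right side at most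
    1/2.\<close>
  moreover have "\<delta> \<le> 1 / 20" using \<delta> by (simp add: power2_eq_square)
  ultimately show False using rare fooled by linarith
qed

text \<open>The exponent \<open>o(1)\<close> is a function \<open>g\<close> tending to 0, and
  \<open>C\<close> is fixed before \<open>g\<close>. As the prescribed dimension need not be an
  integer, \<open>d\<close> ranges over the integers at distance less than 1 from it. The limit of
  \<open>g\<close> enters as \<open>g \<epsilon> < 1 / 20\<close> for small
  \<open>\<epsilon>\<close>.\<close>

theorem theorem3p2:
  "\<exists>C>0. \<forall>g :: real \<Rightarrow> real. (g \<longlongrightarrow> 0) (at_right 0) \<longrightarrow>
     (\<forall>\<^sub>F \<epsilon> :: real in at_right 0.
        \<forall>(d :: nat) (m :: nat) (Q :: nat) (\<delta> :: real) (\<phi> :: real) (R :: real measure)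
          (A :: (nat \<Rightarrow> real) tds_algorithm).
          \<bar>real d - \<epsilon> powr (-1/4)\<bar> < 1 \<longrightarrow>
          1 - \<delta> \<ge> 0.95 \<longrightarrow>
          \<phi> > 0 \<longrightarrow>
          real m \<le> real d powr (ln (1 / \<epsilon>) / ln (ln (1 / \<epsilon>))) \<longrightarrow>
          real Q \<le> 2 powr (real d powr g \<epsilon>) \<longrightarrow>
          (\<forall>r S. at_most_queries (A r S) Q) \<longrightarrow>
          tds_sq_learner (general_halfspaces d) (gaussian d) \<epsilon> \<delta> m \<phi> R A \<longrightarrow>
          \<phi> \<le> real d powr (- (C * (ln (1 / \<epsilon>) / ln (ln (1 / \<epsilon>))))))"
proof (intro exI[of _ "1 / 1000"] conjI allI impI)
  fix g :: "real \<Rightarrow> real"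
  assume "(g \<longlongrightarrow> 0) (at_right 0)"
  then have g: "\<forall>\<^sub>F \<epsilon> in at_right 0. g \<epsilon> < 1 / 20"
    by (rule order_tendstoD) simp
  have "filterlim (\<lambda>\<epsilon> :: real. ln (1 / \<epsilon>)) at_top (at_right 0)" by real_asymp
  from eventually_compose_filterlim[OF eventually_parameters_admissible this]
  show "\<forall>\<^sub>F \<epsilon> :: real in at_right 0.
        \<forall>(d :: nat) (m :: nat) (Q :: nat) (\<delta> :: real) (\<phi> :: real) (R :: real measure)
          (A :: (nat \<Rightarrow> real) tds_algorithm).
          \<bar>real d - \<epsilon> powr (-1/4)\<bar> < 1 \<longrightarrow>
          1 - \<delta> \<ge> 0.95 \<longrightarrow>
          \<phi> > 0 \<longrightarrow>
          real m \<le> real d powr (ln (1 / \<epsilon>) / ln (ln (1 / \<epsilon>))) \<longrightarrow>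
          real Q \<le> 2 powr (real d powr g \<epsilon>) \<longrightarrow>
          (\<forall>r S. at_most_queries (A r S) Q) \<longrightarrow>
          tds_sq_learner (general_halfspaces d) (gaussian d) \<epsilon> \<delta> m \<phi> R A \<longrightarrow>
          \<phi> \<le> real d powr (- (1 / 1000 * (ln (1 / \<epsilon>) / ln (ln (1 / \<epsilon>)))))"
    using g eventually_at_right_less[of 0]
  proof eventually_elim
    case (elim \<epsilon>)
    then show ?case
      using tolerance_bound[OF elim(3) less_imp_le[OF elim(2)]] by blast
  qed
qed simp

end
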